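(* Let $(M,\Lambda,\varepsilon)$ be a Jacobi manifold whose bivector field is decomposed as $\Lambda=\sum_{\kappa=1}^m\Lambda_\kappa\wedge\Lambda^\kappa$ for vector fields $\Lambda_1,\dots,\Lambda_m,\Lambda^1,\dots,\Lambda^m\in\Gamma(TM)$. Then the Jacobi Lie algebroid bracket $[\bullet,\bullet]^J$ on $\Gamma(T^*M)\times C^\infty(M)$ may be expressed as $$[(\alpha,f),(\beta,g)]^J=\nabla_{(\alpha,f)}(\beta,g)-\nabla_{(\beta,g)}(\alpha,f)$$ for all $\alpha,\beta\in\Gamma(T^*M)$ and $f,g\in C^\infty(M)$, where $\nabla:(\Gamma(T^*M)\times C^\infty(M))\times(\Gamma(T^*M)\times C^\infty(M))\to\Gamma(T^*M)\times C^\infty(M)$ is given (with summation over $\kappa=1,\dots,m$) by $$\nabla_{(\alpha,f)}(\beta,g):=\Big([\langle\alpha,\Lambda_\kappa\rangle\mathcal{L}_{\Lambda^\kappa}-\langle\alpha,\Lambda^\kappa\rangle\mathcal{L}_{\Lambda_\kappa}+f\mathcal{L}_\varepsilon](\beta)-\langle\alpha,\varepsilon\rangle\beta,$$ $$[\langle\alpha,\Lambda_\kappa\rangle\mathcal{L}_{\Lambda^\kappa}-\langle\alpha,\Lambda^\kappa\rangle\mathcal{L}_{\Lambda_\kappa}+f\mathcal{L}_\varepsilon](g)+\tfrac12[\langle\alpha,\Lambda^\kappa\rangle\iota_{\Lambda_\kappa}-\langle\alpha,\Lambda_\kappa\rangle\iota_{\Lambda^\kappa}](\beta)\Big).$$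
   Context: A Jacobi manifold $(M,\Lambda,\varepsilon)$ is a smooth manifold $M$ with a bivector field $\Lambda\in\Gamma(\wedge^2TM)$ and a vector field $\varepsilon\in\Gamma(TM)$ satisfying $[\Lambda,\Lambda]=-2\varepsilon\wedge\Lambda$ and $[\varepsilon,\Lambda]=0$ for the Schouten–Nijenhuis bracket. The musical map $\sharp_\Lambda:\Gamma(T^*M)\to\Gamma(TM)$ is defined by $\langle\sharp_\Lambda(\alpha),\beta\rangle:=\Lambda(\alpha,\beta)$. The convention for evaluating the decomposed bivector is $\Lambda(\alpha,\beta)=\sum_\kappa\big(\langle\alpha,\Lambda_\kappa\rangle\langle\beta,\Lambda^\kappa\rangle-\langle\beta,\Lambda_\kappa\rangle\langle\alpha,\Lambda^\kappa\rangle\big)$. $\mathcal{L}$ denotes Lie derivative (on one-forms and functions), $\iota$ contraction, with $\iota_\varepsilon(\alpha\wedge\beta)=\langle\varepsilon,\alpha\rangle\beta-\langle\varepsilon,\beta\rangle\alpha$. Sections of $T^*M\times\mathbb{R}\to M$ are identified with $\Gamma(T^*M)\times C^\infty(M)$. The Jacobi Lie algebroid bracket is $$[(\alpha,f),(\beta,g)]^J=\Big(\mathcal{L}_{\sharp_\Lambda(\alpha)}(\beta)-\mathcal{L}_{\sharp_\Lambda(\beta)}(\alpha)-d(\Lambda(\alpha,\beta))+f\mathcal{L}_\varepsilon(\beta)-g\mathcal{L}_\varepsilon(\alpha)-\iota_\varepsilon(\alpha\wedge\beta),$$ $$\alpha(\sharp_\Lambda(\beta))+\sharp_\Lambda(\alpha)(g)-\sharp_\Lambda(\beta)(f)+f\varepsilon(g)-g\varepsilon(f)\Big).$$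 *)

theory Defs
  imports "HOL-Analysis.Analysis" "HOL-Library.Function_Algebras"
begin

text \<open>
  \<^term>\<open>U\<close> is meant to be relatively open in the linear subspace \<^term>\<open>V\<close>; then the values
  \<^term>\<open>D x v\<close> for \<^term>\<open>v \<in> V\<close> are uniquely determined, and coinduction says that iterated
  derivatives of all orders exist.
\<close>

coinductive smooth_on :: "'e::euclidean_space set \<Rightarrow> 'e set \<Rightarrow> ('e \<Rightarrow> 'b::real_normed_vector) \<Rightarrow> bool"
  for V U where
  "\<lbrakk>\<And>x. x \<in> U \<Longrightarrow> (f has_derivative D x) (at x within U);
    \<And>v. v \<in> V \<Longrightarrow> smooth_on V U (\<lambda>x. D x v)\<rbrakk> \<Longrightarrow> smooth_on V U f"

text \<open>
  The underlying topological space of a manifold is the type \<^typ>\<open>'m\<close>. Charts take values in a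
  linear subspace of a Euclidean space, so that dimension 0 is not excluded.
\<close>

record ('m, 'e) manifold =
  model :: "'e set"
  atlas :: "('m set \<times> ('m \<Rightarrow> 'e)) set"

definition smooth_manifold ::
    "('m::{t2_space, second_countable_topology}, 'e::euclidean_space) manifold \<Rightarrow> bool" where
  "smooth_manifold M \<longleftrightarrow>
     subspace (model M) \<and>
     (\<Union>(U, \<phi>)\<in>atlas M. U) = UNIV \<and>
     (\<forall>(U, \<phi>)\<in>atlas M. open U \<and> openin (top_of_set (model M)) (\<phi> ` U) \<and>
        homeomorphism U (\<phi> ` U) \<phi> (inv_into U \<phi>)) \<and>
     (\<forall>(U, \<phi>)\<in>atlas M. \<forall>(W, \<psi>)\<in>atlas M.
        smooth_on (model M) (\<phi> ` (U \<inter> W)) (\<psi> \<circ> inv_into U \<phi>))"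

definition C_inf :: "('m, 'e::euclidean_space) manifold \<Rightarrow> ('m \<Rightarrow> real) set" where
  "C_inf M = {f. \<forall>(U, \<phi>)\<in>atlas M. smooth_on (model M) (\<phi> ` U) (f \<circ> inv_into U \<phi>)}"

text \<open>
  Tangent vectors at a point are the derivations of the algebra of smooth functions at that point.
  They vanish on non-smooth functions, and covectors vanish on non-tangent arguments, so that
  equality in HOL is equality of tangent vectors, resp. of covectors.
\<close>

type_synonym 'm tvec = "('m \<Rightarrow> real) \<Rightarrow> real"
type_synonym 'm covec = "'m tvec \<Rightarrow> real"
type_synonym 'm vfield = "'m \<Rightarrow> 'm tvec"
type_synonym 'm form1 = "'m \<Rightarrow> 'm covec"
type_synonym 'm mvfield = "'m \<Rightarrow> 'm covec list \<Rightarrow> real"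

definition tangent_space :: "('m, 'e::euclidean_space) manifold \<Rightarrow> 'm \<Rightarrow> 'm tvec set" where
  "tangent_space M p = {v.
     (\<forall>f\<in>C_inf M. \<forall>g\<in>C_inf M. v (f + g) = v f + v g) \<and>
     (\<forall>c. \<forall>f\<in>C_inf M. v (\<lambda>x. c * f x) = c * v f) \<and>
     (\<forall>f\<in>C_inf M. \<forall>g\<in>C_inf M. v (f * g) = f p * v g + g p * v f) \<and>
     (\<forall>f. f \<notin> C_inf M \<longrightarrow> v f = 0)}"

definition cotangent_space :: "('m, 'e::euclidean_space) manifold \<Rightarrow> 'm \<Rightarrow> 'm covec set" where
  "cotangent_space M p = {a.
     (\<forall>v\<in>tangent_space M p. \<forall>w\<in>tangent_space M p. a (v + w) = a v + a w) \<and>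
     (\<forall>c. \<forall>v\<in>tangent_space M p. a (\<lambda>f. c * v f) = c * a v) \<and>
     (\<forall>v. v \<notin> tangent_space M p \<longrightarrow> a v = 0)}"

definition vector_fields :: "('m, 'e::euclidean_space) manifold \<Rightarrow> 'm vfield set" where
  "vector_fields M = {X. (\<forall>p. X p \<in> tangent_space M p) \<and> (\<forall>f\<in>C_inf M. (\<lambda>p. X p f) \<in> C_inf M)}"

definition one_forms :: "('m, 'e::euclidean_space) manifold \<Rightarrow> 'm form1 set" where
  "one_forms M = {\<alpha>. (\<forall>p. \<alpha> p \<in> cotangent_space M p) \<and>
     (\<forall>X\<in>vector_fields M. (\<lambda>p. \<alpha> p (X p)) \<in> C_inf M)}"

definition differential :: "('m, 'e::euclidean_space) manifold \<Rightarrow> ('m \<Rightarrow> real) \<Rightarrow> 'm form1" where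
  "differential M f p v = (if v \<in> tangent_space M p then v f else 0)"

definition pairing :: "'m form1 \<Rightarrow> 'm vfield \<Rightarrow> 'm \<Rightarrow> real" where
  "pairing \<alpha> X p = \<alpha> p (X p)"

definition lie_bracket :: "'m vfield \<Rightarrow> 'm vfield \<Rightarrow> 'm vfield" where
  "lie_bracket X Y p f = X p (\<lambda>q. Y q f) - Y p (\<lambda>q. X q f)"

definition lie_fun :: "'m vfield \<Rightarrow> ('m \<Rightarrow> real) \<Rightarrow> 'm \<Rightarrow> real" where
  "lie_fun X f p = X p f"

text \<open>
  The Lie derivative of a one-form is given by
  $(\mathcal{L}_X\alpha)(Y) = X(\alpha(Y)) - \alpha([X,Y])$. The value at a point depends on $Y$ only
  through its value there, so each tangent vector is extended to some global smooth vector field.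
\<close>

definition extension :: "('m, 'e::euclidean_space) manifold \<Rightarrow> 'm \<Rightarrow> 'm tvec \<Rightarrow> 'm vfield" where
  "extension M p v = (SOME Y. Y \<in> vector_fields M \<and> Y p = v)"

definition lie_form :: "('m, 'e::euclidean_space) manifold \<Rightarrow> 'm vfield \<Rightarrow> 'm form1 \<Rightarrow> 'm form1" where
  "lie_form M X \<alpha> p v =
     (if v \<in> tangent_space M p
      then let Y = extension M p v in lie_fun X (pairing \<alpha> Y) p - pairing \<alpha> (lie_bracket X Y) p
      else 0)"

text \<open>
  A $k$-vector at a point is an alternating $k$-linear form on the cotangent space, represented as a
  function on lists of covectors that vanishes on lists of length other than $k$ and on lists with
  an entry that is not a covector. The exterior product uses the determinant convention
  $(X \wedge Y)(\alpha,\beta) = \alpha(X)\beta(Y) - \beta(X)\alpha(Y)$ without a factor $1/2$,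
  here by expansion along the first factor.
\<close>

definition remove_nth :: "nat \<Rightarrow> 'a list \<Rightarrow> 'a list" where
  "remove_nth i xs = take i xs @ drop (Suc i) xs"

definition vec_wedge ::
    "('m, 'e::euclidean_space) manifold \<Rightarrow> 'm vfield \<Rightarrow> 'm mvfield \<Rightarrow> 'm mvfield" where
  "vec_wedge M X Q p as =
     (if set as \<subseteq> cotangent_space M p
      then \<Sum>i<length as. (-1) ^ i * (as ! i) (X p) * Q p (remove_nth i as)
      else 0)"

primrec wedge :: "('m, 'e::euclidean_space) manifold \<Rightarrow> 'm vfield list \<Rightarrow> 'm mvfield" where
  "wedge M [] = (\<lambda>p as. if as = [] then 1 else 0)"
| "wedge M (X # Xs) = vec_wedge M X (wedge M Xs)"

definition bivector_fields :: "('m, 'e::euclidean_space) manifold \<Rightarrow> 'm mvfield set" where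
  "bivector_fields M = {\<Lambda>.
     (\<forall>p. \<forall>a\<in>cotangent_space M p. \<forall>b\<in>cotangent_space M p.
        \<Lambda> p [a, b] = - \<Lambda> p [b, a] \<and>
        (\<forall>c. \<Lambda> p [\<lambda>v. c * a v, b] = c * \<Lambda> p [a, b]) \<and>
        (\<forall>a'\<in>cotangent_space M p. \<Lambda> p [a + a', b] = \<Lambda> p [a, b] + \<Lambda> p [a', b])) \<and>
     (\<forall>p as. \<not> (length as = 2 \<and> set as \<subseteq> cotangent_space M p) \<longrightarrow> \<Lambda> p as = 0) \<and>
     (\<forall>\<alpha>\<in>one_forms M. \<forall>\<beta>\<in>one_forms M. (\<lambda>p. \<Lambda> p [\<alpha> p, \<beta> p]) \<in> C_inf M)}"

definition bivector_eval :: "'m mvfield \<Rightarrow> 'm form1 \<Rightarrow> 'm form1 \<Rightarrow> 'm \<Rightarrow> real" where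
  "bivector_eval \<Lambda> \<alpha> \<beta> p = \<Lambda> p [\<alpha> p, \<beta> p]"

text \<open>
  The Schouten--Nijenhuis bracket of multivector fields of positive degree is the biadditive
  extension of
  $[X_1\wedge\dots\wedge X_p, Y_1\wedge\dots\wedge Y_q] = \sum_{i,j} (-1)^{i+j}
    [X_i,Y_j]\wedge X_1\wedge\dots\widehat{X_i}\dots\wedge X_p\wedge
    Y_1\wedge\dots\widehat{Y_j}\dots\wedge Y_q$
  (every multivector field is globally a finite sum of decomposable ones). With this sign
  convention, $[\Lambda,\Lambda] = -2\varepsilon\wedge\Lambda$ and $[\varepsilon,\Lambda] = 0$ are
  the conditions for $\{f,g\} = \Lambda(df,dg) + f\varepsilon(g) - g\varepsilon(f)$ to satisfy the
  Jacobi identity.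
\<close>

definition schouten_decomposable ::
    "('m, 'e::euclidean_space) manifold \<Rightarrow> 'm vfield list \<Rightarrow> 'm vfield list \<Rightarrow> 'm mvfield" where
  "schouten_decomposable M Xs Ys p as =
     (\<Sum>i<length Xs. \<Sum>j<length Ys. (-1) ^ (i + j) *
        wedge M (lie_bracket (Xs ! i) (Ys ! j) # remove_nth i Xs @ remove_nth j Ys) p as)"

definition schouten ::
    "('m, 'e::euclidean_space) manifold \<Rightarrow> 'm mvfield \<Rightarrow> 'm mvfield \<Rightarrow> 'm mvfield" where
  "schouten M P Q = (THE R. \<exists>Ps Qs.
     (\<forall>Xs\<in>set Ps \<union> set Qs. Xs \<noteq> [] \<and> set Xs \<subseteq> vector_fields M) \<and>
     P = (\<Sum>Xs\<leftarrow>Ps. wedge M Xs) \<and>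
     Q = (\<Sum>Ys\<leftarrow>Qs. wedge M Ys) \<and>
     R = (\<Sum>Xs\<leftarrow>Ps. \<Sum>Ys\<leftarrow>Qs. schouten_decomposable M Xs Ys))"

definition jacobi_manifold ::
    "('m::{t2_space, second_countable_topology}, 'e::euclidean_space) manifold \<Rightarrow>
      'm mvfield \<Rightarrow> 'm vfield \<Rightarrow> bool" where
  "jacobi_manifold M \<Lambda> \<epsilon> \<longleftrightarrow>
     smooth_manifold M \<and> \<Lambda> \<in> bivector_fields M \<and> \<epsilon> \<in> vector_fields M \<and>
     schouten M \<Lambda> \<Lambda> = (\<lambda>p as. - 2 * vec_wedge M \<epsilon> \<Lambda> p as) \<and>
     schouten M (wedge M [\<epsilon>]) \<Lambda> = 0"

definition sharp :: "('m, 'e::euclidean_space) manifold \<Rightarrow> 'm mvfield \<Rightarrow> 'm form1 \<Rightarrow> 'm vfield" where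
  "sharp M \<Lambda> \<alpha> = (THE X. X \<in> vector_fields M \<and>
     (\<forall>\<beta>\<in>one_forms M. pairing \<beta> X = bivector_eval \<Lambda> \<alpha> \<beta>))"

definition form_wedge :: "'m form1 \<Rightarrow> 'm form1 \<Rightarrow> 'm \<Rightarrow> 'm tvec \<Rightarrow> 'm tvec \<Rightarrow> real" where
  "form_wedge \<alpha> \<beta> p v w = \<alpha> p v * \<beta> p w - \<beta> p v * \<alpha> p w"

definition contract2 :: "'m vfield \<Rightarrow> ('m \<Rightarrow> 'm tvec \<Rightarrow> 'm tvec \<Rightarrow> real) \<Rightarrow> 'm form1" where
  "contract2 X \<omega> p v = \<omega> p (X p) v"

type_synonym 'm jet_section = "'m form1 \<times> ('m \<Rightarrow> real)"

definition scale_form :: "('m \<Rightarrow> real) \<Rightarrow> 'm form1 \<Rightarrow> 'm form1" (infixr "\<cdot>\<^sub>f" 75) where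
  "(h \<cdot>\<^sub>f \<alpha>) p v = h p * \<alpha> p v"

definition jacobi_bracket ::
    "('m, 'e::euclidean_space) manifold \<Rightarrow> 'm mvfield \<Rightarrow> 'm vfield \<Rightarrow>
      'm jet_section \<Rightarrow> 'm jet_section \<Rightarrow> 'm jet_section" where
  "jacobi_bracket M \<Lambda> \<epsilon> = (\<lambda>(\<alpha>, f) (\<beta>, g).
     (lie_form M (sharp M \<Lambda> \<alpha>) \<beta> - lie_form M (sharp M \<Lambda> \<beta>) \<alpha>
        - differential M (bivector_eval \<Lambda> \<alpha> \<beta>)
        + f \<cdot>\<^sub>f lie_form M \<epsilon> \<beta> - g \<cdot>\<^sub>f lie_form M \<epsilon> \<alpha>
        - contract2 \<epsilon> (form_wedge \<alpha> \<beta>),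
      pairing \<alpha> (sharp M \<Lambda> \<beta>) + lie_fun (sharp M \<Lambda> \<alpha>) g - lie_fun (sharp M \<Lambda> \<beta>) f
        + f * lie_fun \<epsilon> g - g * lie_fun \<epsilon> f))"

text \<open>\<^term>\<open>L \<kappa>\<close> and \<^term>\<open>U \<kappa>\<close> are the vector fields $\Lambda_\kappa$ and $\Lambda^\kappa$.\<close>

definition nabla ::
    "('m, 'e::euclidean_space) manifold \<Rightarrow> 'm vfield \<Rightarrow> nat \<Rightarrow> (nat \<Rightarrow> 'm vfield) \<Rightarrow>
      (nat \<Rightarrow> 'm vfield) \<Rightarrow> 'm jet_section \<Rightarrow> 'm jet_section \<Rightarrow> 'm jet_section" where
  "nabla M \<epsilon> m L U = (\<lambda>(\<alpha>, f) (\<beta>, g).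
     ((\<Sum>\<kappa>=1..m. pairing \<alpha> (L \<kappa>) \<cdot>\<^sub>f lie_form M (U \<kappa>) \<beta> - pairing \<alpha> (U \<kappa>) \<cdot>\<^sub>f lie_form M (L \<kappa>) \<beta>)
        + f \<cdot>\<^sub>f lie_form M \<epsilon> \<beta> - pairing \<alpha> \<epsilon> \<cdot>\<^sub>f \<beta>,
      (\<Sum>\<kappa>=1..m. pairing \<alpha> (L \<kappa>) * lie_fun (U \<kappa>) g - pairing \<alpha> (U \<kappa>) * lie_fun (L \<kappa>) g)
        + f * lie_fun \<epsilon> g
        + (\<lambda>_. 1 / 2) * (\<Sum>\<kappa>=1..m. pairing \<alpha> (U \<kappa>) * pairing \<beta> (L \<kappa>)
                                  - pairing \<alpha> (L \<kappa>) * pairing \<beta> (U \<kappa>))))"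

end

theory Submission
  imports Defs
begin

text \<open>
  Write $a_\kappa = \alpha(\Lambda_\kappa)$, $a^\kappa = \alpha(\Lambda^\kappa)$, and similarly
  $b_\kappa$, $b^\kappa$ for $\beta$. The decomposition of $\Lambda$ gives
  $\sharp_\Lambda(\alpha) = \sum_\kappa (a_\kappa \Lambda^\kappa - a^\kappa \Lambda_\kappa)$
  (\<open>decomposed_sharp\<close>). The Lie derivative of a one-form is not function-linear in the vector field;
  instead $\mathcal{L}_{hX}\beta = h\,\mathcal{L}_X\beta + \beta(X)\,dh$ (\<open>lie_form_scale\<close>).
  So $\mathcal{L}_{\sharp\alpha}\beta$ is the Lie derivative part of $\nabla_{(\alpha,f)}(\beta,g)$
  plus the error $\sum_\kappa (b^\kappa\,da_\kappa - b_\kappa\,da^\kappa)$. Exchanging $\alpha$ and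
  $\beta$ and subtracting, the two errors add up to
  $d\sum_\kappa (a_\kappa b^\kappa - b_\kappa a^\kappa) = d(\Lambda(\alpha,\beta))$, which is the
  exact term that the bracket subtracts. The remaining terms match directly:
  $\iota_\varepsilon(\alpha \wedge \beta)$ is the antisymmetrisation of
  $\langle\alpha,\varepsilon\rangle\beta$, and $\alpha(\sharp_\Lambda(\beta)) = \Lambda(\beta,\alpha)$,
  being antisymmetric already, is the antisymmetrisation of one half of itself.

  The rule for $\mathcal{L}_{hX}$ rests on a fact of analysis. Tangent vectors are abstract derivations
  of the algebra of smooth functions, and the value of $\mathcal{L}_X\alpha$ on a tangent vector is
  computed with a global vector field through it. That every derivation at a point extends to such a
  field (\<open>vector_field_extension_exists\<close>) follows from Hadamard's lemma, by which a derivation is a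
  directional derivative in a chart, and from smooth bump functions, which make local coordinate
  fields global. Both need a calculus for the coinductive notion of smoothness: sums, products,
  compositions, gluing along relatively open sets, and integrals over segments with a moving end
  point.
\<close>

section \<open>Calculus of smooth functions\<close>

lemma smooth_onE:
  assumes "smooth_on V U f"
  obtains D where "\<And>x. x \<in> U \<Longrightarrow> (f has_derivative D x) (at x within U)"
    and "\<And>v. v \<in> V \<Longrightarrow> smooth_on V U (\<lambda>x. D x v)"
  using assms by (cases rule: smooth_on.cases) blast

text \<open>
  To show that a function is smooth it suffices to place it in a family \<^term>\<open>P\<close> that is stable
  under differentiation. For the closure properties below, the point is to find such a family.
\<close>

lemma smooth_on_coinduct_family:
  assumes "P f"
    and "\<And>f. P f \<Longrightarrow> \<exists>D. (\<forall>x\<in>U. (f has_derivative D x) (at x within U)) \<and> (\<forall>v\<in>V. P (\<lambda>x. D x v))"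
  shows "smooth_on V U f"
  using assms(1)
proof (coinduction arbitrary: f rule: smooth_on.coinduct)
  case smooth_on
  from assms(2)[OF this] show ?case by blast
qed

lemma smooth_on_cong:
  assumes "smooth_on V U f" and eq: "\<And>x. x \<in> U \<Longrightarrow> g x = f x"
  shows "smooth_on V U g"
proof -
  obtain D where D: "\<And>x. x \<in> U \<Longrightarrow> (f has_derivative D x) (at x within U)"
    and S: "\<And>v. v \<in> V \<Longrightarrow> smooth_on V U (\<lambda>x. D x v)"
    using smooth_onE[OF assms(1)] by metis
  show ?thesis
    by (rule smooth_on.intros[OF has_derivative_transform[OF _ eq D] S])
qed

lemma smooth_on_subset:
  assumes "smooth_on V U f" "U' \<subseteq> U"
  shows "smooth_on V U' f"
proof (rule smooth_on_coinduct_family[where P="\<lambda>f. smooth_on V U f"])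
  fix f :: "'a \<Rightarrow> 'b" assume "smooth_on V U f"
  then obtain D where D: "\<And>x. x \<in> U \<Longrightarrow> (f has_derivative D x) (at x within U)"
    and S: "\<And>v. v \<in> V \<Longrightarrow> smooth_on V U (\<lambda>x. D x v)"
    using smooth_onE by metis
  show "\<exists>D. (\<forall>x\<in>U'. (f has_derivative D x) (at x within U')) \<and> (\<forall>v\<in>V. smooth_on V U (\<lambda>x. D x v))"
    using has_derivative_subset[OF D assms(2)] assms(2) S by blast
qed fact

lemma smooth_on_imp_continuous_on: "smooth_on V U f \<Longrightarrow> continuous_on U f"
  by (elim smooth_onE) (metis has_derivative_continuous continuous_on_eq_continuous_within)

lemma smooth_on_const: "smooth_on V U (\<lambda>_. c)"
proof (rule smooth_on_coinduct_family[where P="\<lambda>f. \<exists>c. f = (\<lambda>_. c)"])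
  fix f :: "'a \<Rightarrow> 'b" assume "\<exists>c. f = (\<lambda>_. c)"
  then show "\<exists>D. (\<forall>x\<in>U. (f has_derivative D x) (at x within U)) \<and> (\<forall>v\<in>V. \<exists>c. (\<lambda>x. D x v) = (\<lambda>_. c))"
    by (intro exI[of _ "\<lambda>_ _. 0"]) (auto intro!: derivative_eq_intros)
qed auto

lemma smooth_on_bounded_linear: "bounded_linear f \<Longrightarrow> smooth_on V U f"
  by (rule smooth_on.intros[of _ _ "\<lambda>_. f"]) (auto intro: bounded_linear_imp_has_derivative smooth_on_const)

lemma smooth_on_linear_image:
  fixes f :: "'a::euclidean_space \<Rightarrow> 'c::real_normed_vector" and h :: "'c \<Rightarrow> 'b::real_normed_vector"
  assumes h: "bounded_linear h" and f: "smooth_on V U f"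
  shows "smooth_on V U (\<lambda>x. h (f x))"
proof (rule smooth_on_coinduct_family[where P="\<lambda>F. \<exists>f::'a \<Rightarrow> 'c. smooth_on V U f \<and> F = (\<lambda>x. h (f x))"])
  fix F :: "'a \<Rightarrow> 'b" assume "\<exists>f::'a \<Rightarrow> 'c. smooth_on V U f \<and> F = (\<lambda>x. h (f x))"
  then obtain f where f: "smooth_on V U f" and F: "F = (\<lambda>x. h (f x))" by blast
  obtain D where D: "\<And>x. x \<in> U \<Longrightarrow> (f has_derivative D x) (at x within U)"
    and S: "\<And>v. v \<in> V \<Longrightarrow> smooth_on V U (\<lambda>x. D x v)"
    using smooth_onE[OF f] by metis
  show "\<exists>D. (\<forall>x\<in>U. (F has_derivative D x) (at x within U)) \<and>
     (\<forall>v\<in>V. \<exists>f. smooth_on V U f \<and> (\<lambda>x. D x v) = (\<lambda>x. h (f x)))"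
    using bounded_linear.has_derivative[OF h D] S unfolding F
    by (intro exI[of _ "\<lambda>x v. h (D x v)"]) blast
qed (use f in blast)

lemma smooth_on_add:
  assumes "smooth_on V U f" "smooth_on V U g"
  shows "smooth_on V U (\<lambda>x. f x + g x)"
proof (rule smooth_on_coinduct_family[where P="\<lambda>F. \<exists>f g. smooth_on V U f \<and> smooth_on V U g \<and> F = (\<lambda>x. f x + g x)"])
  fix F :: "'a \<Rightarrow> 'b" assume "\<exists>f g. smooth_on V U f \<and> smooth_on V U g \<and> F = (\<lambda>x. f x + g x)"
  then obtain f g where f: "smooth_on V U f" and g: "smooth_on V U g" and F: "F = (\<lambda>x. f x + g x)" by blast
  obtain D where D: "\<And>x. x \<in> U \<Longrightarrow> (f has_derivative D x) (at x within U)"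
    and S: "\<And>v. v \<in> V \<Longrightarrow> smooth_on V U (\<lambda>x. D x v)"
    using smooth_onE[OF f] by metis
  obtain E where E: "\<And>x. x \<in> U \<Longrightarrow> (g has_derivative E x) (at x within U)"
    and T: "\<And>v. v \<in> V \<Longrightarrow> smooth_on V U (\<lambda>x. E x v)"
    using smooth_onE[OF g] by metis
  show "\<exists>D. (\<forall>x\<in>U. (F has_derivative D x) (at x within U)) \<and>
     (\<forall>v\<in>V. \<exists>f g. smooth_on V U f \<and> smooth_on V U g \<and> (\<lambda>x. D x v) = (\<lambda>x. f x + g x))"
    using has_derivative_add[OF D E] S T unfolding F
    by (intro exI[of _ "\<lambda>x v. D x v + E x v"]) blast
qed (use assms in blast)

lemma smooth_on_sum:
  assumes "\<And>i. i \<in> I \<Longrightarrow> smooth_on V U (f i)"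
  shows "smooth_on V U (\<lambda>x. \<Sum>i\<in>I. f i x)"
  using assms
  by (induction I rule: infinite_finite_induct) (auto intro: smooth_on_const smooth_on_add)

lemma subspace_projection:
  fixes V :: "'a::euclidean_space set"
  assumes "subspace V"
  obtains P where "bounded_linear P" "\<And>x. P x \<in> V" "\<And>x. x \<in> V \<Longrightarrow> P x = x"
proof -
  obtain g where "range g \<subseteq> V" "linear g" "\<forall>v\<in>V. g v = v"
    using linear_exists_left_inverse_on[OF linear_id assms] by (auto simp: inj_on_def)
  then show thesis using that[of g] linear_conv_bounded_linear by blast
qed

text \<open>
  A derivative within \<^term>\<open>U\<close> sees only directions in \<^term>\<open>V\<close>. Composing it with a projection
  onto \<^term>\<open>V\<close> yields a derivative whose values are smooth in every direction, so that it can be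
  expanded in the standard basis of the ambient space, whose vectors need not lie in \<^term>\<open>V\<close>.
\<close>

lemma smooth_onE_all:
  assumes V: "subspace V" and U: "U \<subseteq> V" and f: "smooth_on V U f"
  obtains D where "\<And>x. x \<in> U \<Longrightarrow> (f has_derivative D x) (at x within U)"
    and "\<And>v. smooth_on V U (\<lambda>x. D x v)"
proof -
  obtain D where D: "\<And>x. x \<in> U \<Longrightarrow> (f has_derivative D x) (at x within U)"
    and S: "\<And>v. v \<in> V \<Longrightarrow> smooth_on V U (\<lambda>x. D x v)"
    using smooth_onE[OF f] by metis
  obtain P where P: "bounded_linear P" "\<And>x. P x \<in> V" "\<And>x. x \<in> V \<Longrightarrow> P x = x"
    using subspace_projection[OF V] by metis
  have PU: "P ` U = U" using P(3) U by (force simp: image_iff)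
  show thesis
  proof (rule that[of "\<lambda>x v. D x (P v)"])
    fix x assume x: "x \<in> U"
    have "((\<lambda>x. f (P x)) has_derivative (\<lambda>v. D x (P v))) (at x within U)"
    proof (rule has_derivative_in_compose[of P P x U f "D x"])
      show "(P has_derivative P) (at x within U)"
        using P(1) by (rule bounded_linear_imp_has_derivative)
      show "(f has_derivative D x) (at (P x) within P ` U)"
        unfolding PU using D[OF x] P(3) x U by auto
    qed
    then show "(f has_derivative (\<lambda>v. D x (P v))) (at x within U)"
      by (rule has_derivative_transform[OF x, rotated]) (use P(3) U in auto)
  next
    fix v show "smooth_on V U (\<lambda>x. D x (P v))" using S P(2) by blast
  qed
qed

text \<open>
  Products and compositions do not form families stable under differentiation, because the chain rule
  turns $F \circ g$ into a sum of products of derivatives of $g$ with functions $F' \circ g$. The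
  algebra generated by the smooth functions and the compositions with $g$ is stable.
\<close>

inductive smooth_closure :: "'a::euclidean_space set \<Rightarrow> 'a set \<Rightarrow> 'c::euclidean_space set \<Rightarrow> 'c set \<Rightarrow>
    ('a \<Rightarrow> 'c) \<Rightarrow> ('a \<Rightarrow> real) \<Rightarrow> bool" for V U V' W g where
  base: "smooth_on V U u \<Longrightarrow> smooth_closure V U V' W g u"
| comp: "smooth_on V' W F \<Longrightarrow> smooth_closure V U V' W g (\<lambda>x. F (g x))"
| add: "smooth_closure V U V' W g u \<Longrightarrow> smooth_closure V U V' W g v \<Longrightarrow> smooth_closure V U V' W g (\<lambda>x. u x + v x)"
| mult: "smooth_closure V U V' W g u \<Longrightarrow> smooth_closure V U V' W g v \<Longrightarrow> smooth_closure V U V' W g (\<lambda>x. u x * v x)"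

lemma smooth_closure_sum:
  assumes "\<And>i. i \<in> I \<Longrightarrow> smooth_closure V U V' W g (f i)"
  shows "smooth_closure V U V' W g (\<lambda>x. \<Sum>i\<in>I. f i x)"
  using assms
  by (induction I rule: infinite_finite_induct)
     (auto intro: smooth_closure.base smooth_on_const smooth_closure.add)

lemma smooth_on_closure:
  assumes V': "subspace V'" and W: "W \<subseteq> V'" and g: "smooth_on V U g" and gU: "g ` U \<subseteq> W"
    and "smooth_closure V U V' W g u"
  shows "smooth_on V U u"
proof (rule smooth_on_coinduct_family[where P="smooth_closure V U V' W g"])
  fix u assume "smooth_closure V U V' W g u"
  then show "\<exists>D. (\<forall>x\<in>U. (u has_derivative D x) (at x within U)) \<and>
             (\<forall>v\<in>V. smooth_closure V U V' W g (\<lambda>x. D x v))"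
  proof induction
    case (base u)
    then obtain D where "\<And>x. x \<in> U \<Longrightarrow> (u has_derivative D x) (at x within U)"
      "\<And>v. v \<in> V \<Longrightarrow> smooth_on V U (\<lambda>x. D x v)"
      using smooth_onE by metis
    then show ?case by (blast intro: smooth_closure.base)
  next
    case (comp F)
    obtain D where D: "\<And>x. x \<in> W \<Longrightarrow> (F has_derivative D x) (at x within W)"
      and S: "\<And>v. smooth_on V' W (\<lambda>x. D x v)"
      using smooth_onE_all[OF V' W comp] by metis
    obtain E where E: "\<And>x. x \<in> U \<Longrightarrow> (g has_derivative E x) (at x within U)"
      and T: "\<And>v. v \<in> V \<Longrightarrow> smooth_on V U (\<lambda>x. E x v)"
      using smooth_onE[OF g] by metis
    let ?D = "\<lambda>x v. \<Sum>b\<in>Basis. (E x v \<bullet> b) * D (g x) b"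
    have "((\<lambda>x. F (g x)) has_derivative ?D x) (at x within U)" if x: "x \<in> U" for x
    proof (rule has_derivative_eq_rhs)
      show "((\<lambda>x. F (g x)) has_derivative (\<lambda>v. D (g x) (E x v))) (at x within U)"
        by (rule has_derivative_in_compose2[OF D gU x E[OF x]])
      have l: "linear (D (g x))"
        using D[of "g x"] gU x by (meson has_derivative_linear image_subset_iff)
      have "D (g x) (E x v) = D (g x) (\<Sum>b\<in>Basis. (E x v \<bullet> b) *\<^sub>R b)" for v
        by (simp add: euclidean_representation)
      then show "(\<lambda>v. D (g x) (E x v)) = ?D x"
        by (simp add: linear_sum[OF l] linear_cmul[OF l])
    qed
    moreover have "smooth_closure V U V' W g (\<lambda>x. ?D x v)" if "v \<in> V" for v
      by (intro smooth_closure_sum smooth_closure.mult smooth_closure.base smooth_closure.comp[of V' W "\<lambda>y. D y b" for b]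
          S smooth_on_linear_image[OF bounded_linear_inner_left] T that)
    ultimately show ?case by (intro exI[of _ ?D]) blast
  next
    case (add u v)
    then obtain D E where D: "\<forall>x\<in>U. (u has_derivative D x) (at x within U)"
      "\<forall>v\<in>V. smooth_closure V U V' W g (\<lambda>x. D x v)" and
      E: "\<forall>x\<in>U. (v has_derivative E x) (at x within U)"
      "\<forall>v\<in>V. smooth_closure V U V' W g (\<lambda>x. E x v)" by blast
    show ?case
      by (rule exI[of _ "\<lambda>x w. D x w + E x w"])
        (use D E in \<open>auto intro!: has_derivative_add smooth_closure.add\<close>)
  next
    case (mult u v)
    then obtain D E where D: "\<forall>x\<in>U. (u has_derivative D x) (at x within U)"
      "\<forall>v\<in>V. smooth_closure V U V' W g (\<lambda>x. D x v)" and
      E: "\<forall>x\<in>U. (v has_derivative E x) (at x within U)"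
      "\<forall>v\<in>V. smooth_closure V U V' W g (\<lambda>x. E x v)" by blast
    show ?case
      by (rule exI[of _ "\<lambda>x w. u x * E x w + D x w * v x"])
        (use D E mult.hyps in \<open>auto intro!: has_derivative_mult smooth_closure.add smooth_closure.mult\<close>)
  qed
qed fact

lemma smooth_on_mult:
  fixes f g :: "'a::euclidean_space \<Rightarrow> real"
  assumes "smooth_on V U f" "smooth_on V U g"
  shows "smooth_on V U (\<lambda>x. f x * g x)"
proof (rule smooth_on_closure[of "{0::real}" "{0}" V U "\<lambda>_. 0"])
  show "smooth_closure V U {0::real} {0} (\<lambda>_. 0) (\<lambda>x. f x * g x)"
    using assms by (intro smooth_closure.mult smooth_closure.base)
qed (auto intro: smooth_on_const simp: subspace_def)

lemma smooth_on_compose: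
  fixes g :: "'a::euclidean_space \<Rightarrow> 'c::euclidean_space" and f :: "'c \<Rightarrow> real"
  assumes "subspace V'" "W \<subseteq> V'" "smooth_on V' W f" "smooth_on V U g" "g ` U \<subseteq> W"
  shows "smooth_on V U (\<lambda>x. f (g x))"
  using smooth_on_closure[OF assms(1,2,4,5)] smooth_closure.comp[OF assms(3)] by blast

lemma smooth_on_diff:
  assumes "smooth_on V U f" "smooth_on V U g"
  shows "smooth_on V U (\<lambda>x. f x - g x)"
  using smooth_on_add[OF assms(1) smooth_on_linear_image[OF bounded_linear_minus[OF bounded_linear_ident] assms(2)]]
  by simp

text \<open>
  The values of a derivative within a relatively open subset of \<^term>\<open>V\<close> are determined along
  \<^term>\<open>V\<close>, being derivatives along lines; this formula names them without choosing a derivative.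
\<close>

definition dir_deriv :: "('a::real_normed_vector \<Rightarrow> 'b::real_normed_vector) \<Rightarrow> 'a \<Rightarrow> 'a \<Rightarrow> 'b" where
  "dir_deriv f v x = vector_derivative (\<lambda>t. f (x + t *\<^sub>R v)) (at 0)"

lemma has_derivative_imp_dir_deriv:
  assumes V: "subspace V" and U: "openin (top_of_set V) U" and x: "x \<in> U" and v: "v \<in> V"
    and D: "(f has_derivative D) (at x within U)"
  shows "D v = dir_deriv f v x"
proof -
  obtain T where T: "open T" "U = V \<inter> T" using U by (auto simp: openin_open)
  \<comment> \<open>The line through x in direction v stays in U for parameters in an open set around 0.\<close>
  define S where "S = (\<lambda>t. x + t *\<^sub>R v) -` T"
  have S: "open S" unfolding S_def by (intro open_vimage T continuous_intros)
  have S0: "0 \<in> S" using x T by (auto simp: S_def)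
  have SU: "(\<lambda>t. x + t *\<^sub>R v) ` S \<subseteq> U"
    using V x v T by (auto simp: S_def intro: subspace_add subspace_scale)
  have "((\<lambda>t. f (x + t *\<^sub>R v)) has_derivative (\<lambda>t. D (t *\<^sub>R v))) (at 0 within S)"
  proof (rule has_derivative_in_compose[where f="\<lambda>t. x + t *\<^sub>R v" and g=f])
    show "((\<lambda>t. x + t *\<^sub>R v) has_derivative (\<lambda>t. t *\<^sub>R v)) (at 0 within S)"
      by (auto intro!: derivative_eq_intros)
    show "(f has_derivative D) (at (x + 0 *\<^sub>R v) within (\<lambda>t. x + t *\<^sub>R v) ` S)"
      using has_derivative_subset[OF D SU] by simp
  qed
  then have "((\<lambda>t. f (x + t *\<^sub>R v)) has_vector_derivative D v) (at 0)"
    using at_within_open[OF S0 S] has_derivative_linear[OF D]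
    by (simp add: has_vector_derivative_def linear_cmul)
  then show ?thesis by (simp add: dir_deriv_def vector_derivative_at)
qed

lemma smooth_on_has_derivative_dir_deriv:
  assumes "subspace V" "openin (top_of_set V) U" "smooth_on V U f" "x \<in> U"
  obtains D where "(f has_derivative D) (at x within U)" "\<And>v. v \<in> V \<Longrightarrow> D v = dir_deriv f v x"
  using assms smooth_onE[OF assms(3)] has_derivative_imp_dir_deriv[OF assms(1,2)] by metis

lemma smooth_on_dir_deriv:
  assumes V: "subspace V" and U: "openin (top_of_set V) U" and f: "smooth_on V U f" and v: "v \<in> V"
  shows "smooth_on V U (dir_deriv f v)"
proof -
  obtain D where D: "\<And>x. x \<in> U \<Longrightarrow> (f has_derivative D x) (at x within U)"
    and S: "\<And>v. v \<in> V \<Longrightarrow> smooth_on V U (\<lambda>x. D x v)"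
    using smooth_onE[OF f] by metis
  show ?thesis
    by (rule smooth_on_cong[OF S[OF v]]) (simp add: has_derivative_imp_dir_deriv[OF V U _ v D])
qed

lemma at_within_openin_subset:
  assumes "openin (top_of_set V) U" "U \<subseteq> W" "W \<subseteq> V" "x \<in> U"
  shows "at x within W = at x within U"
proof -
  obtain T where "open T" "U = V \<inter> T" using assms(1) by (auto simp: openin_open)
  then show ?thesis using assms by (intro at_within_nhd[of x T]) auto
qed

text \<open>
  Derivatives chosen on the two pieces agree on the overlap because both are directional derivatives.
  Hence gluing them keeps their values smooth on each piece.
\<close>

lemma smooth_on_Un:
  assumes V: "subspace V" and U1: "openin (top_of_set V) U1" and U2: "openin (top_of_set V) U2"
    and "smooth_on V U1 f" "smooth_on V U2 f"
  shows "smooth_on V (U1 \<union> U2) f"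
proof (rule smooth_on_coinduct_family[where P="\<lambda>f. smooth_on V U1 f \<and> smooth_on V U2 f"])
  fix f :: "'a \<Rightarrow> 'b" assume f: "smooth_on V U1 f \<and> smooth_on V U2 f"
  obtain D1 where D1: "\<And>x. x \<in> U1 \<Longrightarrow> (f has_derivative D1 x) (at x within U1)"
    and S1: "\<And>v. v \<in> V \<Longrightarrow> smooth_on V U1 (\<lambda>x. D1 x v)"
    using smooth_onE f by metis
  obtain D2 where D2: "\<And>x. x \<in> U2 \<Longrightarrow> (f has_derivative D2 x) (at x within U2)"
    and S2: "\<And>v. v \<in> V \<Longrightarrow> smooth_on V U2 (\<lambda>x. D2 x v)"
    using smooth_onE f by metis
  have sub: "U1 \<subseteq> V" "U2 \<subseteq> V" using U1 U2 openin_imp_subset by auto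
  let ?D = "\<lambda>x. if x \<in> U1 then D1 x else D2 x"
  have "(f has_derivative ?D x) (at x within U1 \<union> U2)" if "x \<in> U1 \<union> U2" for x
    using that D1 D2 at_within_openin_subset[OF U1, of "U1 \<union> U2" x]
      at_within_openin_subset[OF U2, of "U1 \<union> U2" x] sub by auto
  moreover have "smooth_on V U1 (\<lambda>x. ?D x v)" if "v \<in> V" for v
    by (rule smooth_on_cong[OF S1[OF that]]) simp
  moreover have "smooth_on V U2 (\<lambda>x. ?D x v)" if "v \<in> V" for v
    by (rule smooth_on_cong[OF S2[OF that]])
      (simp add: has_derivative_imp_dir_deriv[OF V U1 _ that D1] has_derivative_imp_dir_deriv[OF V U2 _ that D2])
  ultimately show "\<exists>D. (\<forall>x\<in>U1 \<union> U2. (f has_derivative D x) (at x within U1 \<union> U2)) \<and>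
      (\<forall>v\<in>V. smooth_on V U1 (\<lambda>x. D x v) \<and> smooth_on V U2 (\<lambda>x. D x v))"
    by (intro exI[of _ ?D]) blast
qed (use assms in blast)

section \<open>Smooth bump functions\<close>

text \<open>
  The functions $p(1/t)\,e^{-1/t}$, continued by 0 to $t \le 0$, with $p$ a polynomial. Differentiation
  replaces $p$ by $X^2 (p - p')$, so they are stable under it, and all of them are flat at 0.
\<close>

definition flat :: "real poly \<Rightarrow> real \<Rightarrow> real" where
  "flat p t = (if 0 < t then poly p (1 / t) * exp (- 1 / t) else 0)"

lemma flat_tendsto_0: "(flat p \<longlongrightarrow> 0) (at 0)"
proof -
  have "((\<lambda>x::real. poly p x * exp (- x)) \<longlongrightarrow> 0) at_top"
  proof -
    have "((\<lambda>x::real. \<Sum>i\<le>degree p. coeff p i * (x ^ i / exp x)) \<longlongrightarrow> (\<Sum>i\<le>degree p. coeff p i * 0)) at_top"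
      by (intro tendsto_intros tendsto_power_div_exp_0)
    then show ?thesis
      by (simp add: poly_altdef sum_distrib_left exp_minus divide_inverse mult_ac)
  qed
  then have "((\<lambda>t. poly p (inverse t) * exp (- inverse t)) \<longlongrightarrow> 0) (at_right 0)"
    by (simp add: filterlim_at_right_to_top)
  then have "(flat p \<longlongrightarrow> 0) (at_right 0)"
    by (rule Lim_transform_eventually)
      (auto simp: flat_def eventually_at_filter inverse_eq_divide)
  moreover have "(flat p \<longlongrightarrow> 0) (at_left 0)"
    by (rule tendsto_eventually) (auto simp: flat_def eventually_at_filter)
  ultimately show ?thesis by (simp add: filterlim_at_split)
qed

lemma flat_has_derivative:
  "(flat p has_field_derivative flat ([:0, 0, 1:] * (p - pderiv p)) t) (at t)"
proof (cases "t = 0")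
  case True
  have "((\<lambda>h. (flat p h - flat p 0) / (h - 0)) \<longlongrightarrow> 0) (at 0)"
  proof (rule Lim_transform_eventually[OF flat_tendsto_0[of "pCons 0 p"]])
    show "\<forall>\<^sub>F h in at 0. flat (pCons 0 p) h = (flat p h - flat p 0) / (h - 0)"
      by (auto simp: flat_def)
  qed
  then show ?thesis using True by (simp add: has_field_derivative_iff flat_def)
next
  case False
  show ?thesis
  proof (cases "t > 0")
    case True
    have "((\<lambda>t. poly p (1 / t) * exp (- 1 / t)) has_field_derivative flat ([:0, 0, 1:] * (p - pderiv p)) t) (at t)"
      using True by (auto intro!: derivative_eq_intros DERIV_chain2[OF poly_DERIV] simp: flat_def field_simps power2_eq_square)
    then show ?thesis
      by (rule has_field_derivative_transform_within_open[of _ _ _ "{0<..}"]) (use True in \<open>auto simp: flat_def\<close>)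
  next
    case F: False
    have "((\<lambda>t. 0) has_field_derivative flat ([:0, 0, 1:] * (p - pderiv p)) t) (at t)"
      using F by (simp add: flat_def)
    then show ?thesis
      by (rule has_field_derivative_transform_within_open[of _ _ _ "{..<0}"]) (use F False in \<open>auto simp: flat_def\<close>)
  qed
qed

lemma smooth_on_flat: "smooth_on UNIV UNIV (flat p)"
proof (rule smooth_on_coinduct_family[where P="\<lambda>f. \<exists>c p. f = (\<lambda>t. c * flat p t)"])
  fix f :: "real \<Rightarrow> real" assume "\<exists>c p. f = (\<lambda>t. c * flat p t)"
  then obtain c p where f: "f = (\<lambda>t. c * flat p t)" by blast
  let ?q = "[:0, 0, 1:] * (p - pderiv p)"
  have "(f has_derivative (\<lambda>v. (c * v) * flat ?q x)) (at x)" for x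
    using DERIV_cmult[OF flat_has_derivative[of p x], of c] unfolding f has_field_derivative_def
    by (rule has_derivative_eq_rhs) (simp add: fun_eq_iff mult_ac)
  then show "\<exists>D. (\<forall>x\<in>UNIV. (f has_derivative D x) (at x)) \<and>
      (\<forall>v\<in>UNIV. \<exists>c p. (\<lambda>x. D x v) = (\<lambda>t. c * flat p t))"
    by (intro exI[of _ "\<lambda>x v. (c * v) * flat ?q x"]) blast
qed (rule exI[of _ 1], rule exI[of _ p], simp)

lemma smooth_on_bump:
  fixes a :: "'a::euclidean_space"
  shows "smooth_on V U (\<lambda>x. flat 1 (r\<^sup>2 - (norm (x - a))\<^sup>2))"
proof (rule smooth_on_compose[of UNIV UNIV "flat 1" V U "\<lambda>x. r\<^sup>2 - (norm (x - a))\<^sup>2"])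
  have "(norm y)\<^sup>2 = (\<Sum>b\<in>Basis. (y \<bullet> b) * (y \<bullet> b))" for y :: 'a
    by (simp only: power2_norm_eq_inner euclidean_inner[of y y])
  then have eq: "(\<lambda>x. r\<^sup>2 - (norm (x - a))\<^sup>2) = (\<lambda>x. r\<^sup>2 - (\<Sum>b\<in>Basis. (x \<bullet> b - a \<bullet> b) * (x \<bullet> b - a \<bullet> b)))"
    by (simp add: inner_diff_left)
  show "smooth_on V U (\<lambda>x. r\<^sup>2 - (norm (x - a))\<^sup>2)"
    unfolding eq
    by (intro smooth_on_diff smooth_on_const smooth_on_sum smooth_on_mult
        smooth_on_bounded_linear bounded_linear_inner_left)
qed (auto intro: smooth_on_flat)

section \<open>Hadamard's lemma\<close>

lemma segment_in_convex:
  assumes "convex U" "a \<in> U" "x \<in> U" "t \<in> {0..1::real}"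
  shows "a + t *\<^sub>R (x - a) \<in> U"
  using convexD_alt[OF assms(1,2,3), of t] assms(4) by (simp add: algebra_simps)

text \<open>
  Differentiating under the integral sign turns the integrand $t^k H(a + t(x - a))$ into
  $t^{k+1} H'(a + t(x - a)) v$, again of the same form. The weight $t^k$ is what makes the family
  stable; the application has $k = 0$.
\<close>

lemma smooth_on_segment_integral:
  fixes H :: "'a::euclidean_space \<Rightarrow> real"
  assumes V: "subspace V" and UV: "U \<subseteq> V" and conv: "convex U" and a: "a \<in> U"
    and H: "smooth_on V U H"
  shows "smooth_on V U (\<lambda>x. integral {0..1} (\<lambda>t. t ^ k * H (a + t *\<^sub>R (x - a))))"
proof (rule smooth_on_coinduct_family[where
      P="\<lambda>F. \<exists>H k. smooth_on V U H \<and> F = (\<lambda>x. integral {0..1} (\<lambda>t. t ^ k * H (a + t *\<^sub>R (x - a))))"])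
  fix F :: "'a \<Rightarrow> real"
  assume "\<exists>H k. smooth_on V U H \<and> F = (\<lambda>x. integral {0..1} (\<lambda>t. t ^ k * H (a + t *\<^sub>R (x - a))))"
  then obtain H k where H: "smooth_on V U H"
    and F: "F = (\<lambda>x. integral {0..1} (\<lambda>t. t ^ k * H (a + t *\<^sub>R (x - a))))" by blast
  note seg = segment_in_convex[OF conv a]
  obtain D where D: "\<And>x. x \<in> U \<Longrightarrow> (H has_derivative D x) (at x within U)"
    and S: "\<And>v. smooth_on V U (\<lambda>x. D x v)"
    using smooth_onE_all[OF V UV H] by metis
  have cont: "continuous_on (U \<times> {0..1}) (\<lambda>(x, t). t ^ j * G (a + t *\<^sub>R (x - a)))"
    if "smooth_on V U G" for G :: "'a \<Rightarrow> real" and j :: nat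
    unfolding split_beta
    by (intro continuous_intros continuous_on_compose2[OF smooth_on_imp_continuous_on[OF that]])
      (auto intro: seg)
  have cont1: "continuous_on {0..1} (\<lambda>t. t ^ j * G (a + t *\<^sub>R (x - a)))"
    if "smooth_on V U G" "x \<in> U" for G :: "'a \<Rightarrow> real" and j :: nat and x
    using continuous_on_compose2[OF cont[OF that(1), of j], of "{0..1}" "\<lambda>t. (x, t)"] that(2)
    by (fastforce intro: continuous_intros)
  \<comment> \<open>The Leibniz rule wants the derivative to be continuous in operator norm, which in finite
    dimension follows from continuity in each direction.\<close>
  let ?L = "\<lambda>x t. Blinfun (\<lambda>v. t ^ Suc k * D (a + t *\<^sub>R (x - a)) v)"
  have L: "blinfun_apply (?L x t) = (\<lambda>v. t ^ Suc k * D (a + t *\<^sub>R (x - a)) v)"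
    if "x \<in> U" "t \<in> {0..1}" for x t
    by (intro bounded_linear_Blinfun_apply bounded_linear_const_mult)
      (rule has_derivative_bounded_linear[OF D[OF seg[OF that]]])
  have contL: "continuous_on (U \<times> {0..1}) (\<lambda>(x, t). ?L x t)"
  proof (rule continuous_on_blinfun_componentwise)
    fix i :: 'a assume "i \<in> Basis"
    show "continuous_on (U \<times> {0..1}) (\<lambda>p. blinfun_apply (case p of (x, t) \<Rightarrow> ?L x t) i)"
      by (rule continuous_on_eq[OF cont[OF S[of i], of "Suc k"]]) (auto simp: L simp del: power_Suc)
  qed
  let ?E = "\<lambda>x v. integral {0..1} (\<lambda>t. t ^ Suc k * D (a + t *\<^sub>R (x - a)) v)"
  have "(F has_derivative ?E x) (at x within U)" if x: "x \<in> U" for x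
  proof -
    have "((\<lambda>x. integral (cbox 0 1) (\<lambda>t. t ^ k * H (a + t *\<^sub>R (x - a)))) has_derivative
          blinfun_apply (integral (cbox 0 1) (?L x))) (at x within U)"
    proof (rule leibniz_rule[OF _ _ _ x conv])
      fix y t assume y: "y \<in> U" and t: "t \<in> cbox 0 (1::real)"
      have "((\<lambda>y. H (a + t *\<^sub>R (y - a))) has_derivative (\<lambda>v. D (a + t *\<^sub>R (y - a)) (t *\<^sub>R v))) (at y within U)"
        by (rule has_derivative_in_compose2[OF D _ y])
          (use seg t in \<open>auto intro!: derivative_eq_intros\<close>)
      then have "((\<lambda>y. t ^ k * H (a + t *\<^sub>R (y - a))) has_derivative
          (\<lambda>v. t ^ k * D (a + t *\<^sub>R (y - a)) (t *\<^sub>R v))) (at y within U)"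
        by (rule has_derivative_mult_right)
      moreover have "linear (D (a + t *\<^sub>R (y - a)))"
        using has_derivative_linear[OF D] seg y t by auto
      ultimately show "((\<lambda>y. t ^ k * H (a + t *\<^sub>R (y - a))) has_derivative blinfun_apply (?L y t)) (at y within U)"
        using L[OF y] t by (simp add: linear_cmul mult_ac)
    next
      fix y assume "y \<in> U"
      then show "(\<lambda>t. t ^ k * H (a + t *\<^sub>R (y - a))) integrable_on cbox 0 1"
        using integrable_continuous_real[OF cont1[OF H]] by simp
    next
      show "continuous_on (U \<times> cbox 0 1) (\<lambda>(x, t). ?L x t)" using contL by simp
    qed
    moreover have "(?L x) integrable_on {0..1}"
    proof (rule integrable_continuous_real)
      show "continuous_on {0..1} (?L x)"
        using continuous_on_compose2[OF contL, of "{0..1}" "\<lambda>t. (x, t)"] x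
        by (fastforce intro: continuous_intros)
    qed
    then have "blinfun_apply (integral {0..1} (?L x)) v = ?E x v" for v
      by (subst blinfun_apply_integral)
        (auto simp: L[OF x] simp del: power_Suc intro!: integral_cong)
    then have "blinfun_apply (integral {0..1} (?L x)) = ?E x" by blast
    ultimately show ?thesis unfolding F by (simp only: box_real)
  qed
  then show "\<exists>D. (\<forall>x\<in>U. (F has_derivative D x) (at x within U)) \<and>
      (\<forall>v\<in>V. \<exists>H k. smooth_on V U H \<and> (\<lambda>x. D x v) =
          (\<lambda>x. integral {0..1} (\<lambda>t. t ^ k * H (a + t *\<^sub>R (x - a)))))"
    using S by (intro exI[of _ ?E]) blast
qed (use H in blast)

text \<open>
  The fundamental theorem of calculus along the segment from \<^term>\<open>a\<close> to \<^term>\<open>x\<close> gives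
  $f(x) - f(a) = \int_0^1 f'(a + t(x-a))(x-a)\,dt$; expanding $x - a$ in the standard basis, after
  projecting the basis vectors to \<^term>\<open>V\<close>, produces the functions \<^term>\<open>g\<close>.
\<close>

lemma hadamard:
  fixes f :: "'a::euclidean_space \<Rightarrow> real"
  assumes V: "subspace V" and U: "openin (top_of_set V) U" and conv: "convex U" and a: "a \<in> U"
    and f: "smooth_on V U f"
    and P: "bounded_linear P" "\<And>x. P x \<in> V" "\<And>x. x \<in> V \<Longrightarrow> P x = x"
  shows "\<exists>g. (\<forall>b. smooth_on V U (g b) \<and> g b a = dir_deriv f (P b) a) \<and>
    (\<forall>x\<in>U. f x = f a + (\<Sum>b\<in>Basis. ((x - a) \<bullet> b) * g b x))"
proof -
  have UV: "U \<subseteq> V" using U openin_imp_subset by blast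
  note seg = segment_in_convex[OF conv a]
  let ?g = "\<lambda>b x. integral {0..1} (\<lambda>t. t ^ 0 * dir_deriv f (P b) (a + t *\<^sub>R (x - a)))"
  have "smooth_on V U (?g b)" for b
    by (rule smooth_on_segment_integral[OF V UV conv a smooth_on_dir_deriv[OF V U f P(2)]])
  moreover have "?g b a = dir_deriv f (P b) a" for b by simp
  moreover have "f x = f a + (\<Sum>b\<in>Basis. ((x - a) \<bullet> b) * ?g b x)" if x: "x \<in> U" for x
  proof -
    let ?s = "\<lambda>t. a + t *\<^sub>R (x - a)"
    have xa: "x - a \<in> V" using x a UV V subspace_diff by blast
    have "((\<lambda>t. f (?s t)) has_vector_derivative (\<Sum>b\<in>Basis. ((x - a) \<bullet> b) * dir_deriv f (P b) (?s t))) (at t within {0..1})"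
      if t: "t \<in> {0..1}" for t
    proof -
      obtain D where D: "(f has_derivative D) (at (?s t) within U)" "\<And>v. v \<in> V \<Longrightarrow> D v = dir_deriv f v (?s t)"
        using smooth_on_has_derivative_dir_deriv[OF V U f seg[OF x t]] by blast
      have lin: "linear D" "linear P" using has_derivative_linear[OF D(1)] P(1) bounded_linear.linear by auto
      have "((\<lambda>t. f (?s t)) has_derivative (\<lambda>h. D (h *\<^sub>R (x - a)))) (at t within {0..1})"
      proof (rule has_derivative_in_compose[where f="?s" and g=f])
        show "(?s has_derivative (\<lambda>h. h *\<^sub>R (x - a))) (at t within {0..1})"
          by (auto intro!: derivative_eq_intros)
        show "(f has_derivative D) (at (?s t) within ?s ` {0..1})"
          by (rule has_derivative_subset[OF D(1)]) (use seg[OF x] in auto)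
      qed
      moreover have "D (x - a) = (\<Sum>b\<in>Basis. ((x - a) \<bullet> b) * dir_deriv f (P b) (?s t))"
      proof -
        have "D (x - a) = D (P (\<Sum>b\<in>Basis. ((x - a) \<bullet> b) *\<^sub>R b))"
          by (simp only: euclidean_representation P(3)[OF xa])
        also have "\<dots> = (\<Sum>b\<in>Basis. ((x - a) \<bullet> b) * D (P b))"
          by (simp only: linear_sum[OF lin(1)] linear_cmul[OF lin(1)] linear_sum[OF lin(2)] linear_cmul[OF lin(2)] real_scaleR_def)
        finally show ?thesis by (simp add: D(2) P(2))
      qed
      ultimately show ?thesis by (simp add: has_vector_derivative_def linear_cmul[OF lin(1)])
    qed
    then have "((\<lambda>t. \<Sum>b\<in>Basis. ((x - a) \<bullet> b) * dir_deriv f (P b) (?s t)) has_integral f (?s 1) - f (?s 0)) {0..1}"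
      by (intro fundamental_theorem_of_calculus) auto
    then have "f x - f a = integral {0..1} (\<lambda>t. \<Sum>b\<in>Basis. ((x - a) \<bullet> b) * dir_deriv f (P b) (?s t))"
      by (simp add: has_integral_iff)
    also have "\<dots> = (\<Sum>b\<in>Basis. integral {0..1} (\<lambda>t. ((x - a) \<bullet> b) * dir_deriv f (P b) (?s t)))"
    proof (rule integral_sum)
      fix b :: 'a assume "b \<in> Basis"
      show "(\<lambda>t. ((x - a) \<bullet> b) * dir_deriv f (P b) (?s t)) integrable_on {0..1}"
        by (intro integrable_continuous_real continuous_intros
            continuous_on_compose2[OF smooth_on_imp_continuous_on[OF smooth_on_dir_deriv[OF V U f P(2)]]])
          (auto intro: seg[OF x])
    qed simp
    finally show ?thesis by simp
  qed
  ultimately show ?thesis by (intro exI[of _ ?g]) blast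
qed

section \<open>Smooth functions and derivations on a manifold\<close>

lemma C_inf_const: "(\<lambda>_. c) \<in> C_inf M"
  by (auto simp: C_inf_def comp_def smooth_on_const)

lemma C_inf_add: "f \<in> C_inf M \<Longrightarrow> g \<in> C_inf M \<Longrightarrow> (\<lambda>x. f x + g x) \<in> C_inf M"
  by (fastforce simp: C_inf_def comp_def intro: smooth_on_add)

lemma C_inf_mult: "f \<in> C_inf M \<Longrightarrow> g \<in> C_inf M \<Longrightarrow> (\<lambda>x. f x * g x) \<in> C_inf M"
  by (fastforce simp: C_inf_def comp_def intro: smooth_on_mult)

lemma C_inf_diff: "f \<in> C_inf M \<Longrightarrow> g \<in> C_inf M \<Longrightarrow> (\<lambda>x. f x - g x) \<in> C_inf M"
  by (fastforce simp: C_inf_def comp_def intro: smooth_on_diff)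

lemma C_inf_sum: "(\<And>i. i \<in> I \<Longrightarrow> f i \<in> C_inf M) \<Longrightarrow> (\<lambda>x. \<Sum>i\<in>I. f i x) \<in> C_inf M"
  by (induction I rule: infinite_finite_induct) (auto intro: C_inf_const C_inf_add)

lemma tangent_space_simps:
  assumes "v \<in> tangent_space M p"
  shows tangent_add: "f \<in> C_inf M \<Longrightarrow> g \<in> C_inf M \<Longrightarrow> v (\<lambda>x. f x + g x) = v f + v g"
    and tangent_cmult: "f \<in> C_inf M \<Longrightarrow> v (\<lambda>x. c * f x) = c * v f"
    and tangent_mult: "f \<in> C_inf M \<Longrightarrow> g \<in> C_inf M \<Longrightarrow> v (\<lambda>x. f x * g x) = f p * v g + g p * v f"
    and tangent_not_smooth: "f \<notin> C_inf M \<Longrightarrow> v f = 0"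
  using assms by (auto simp: tangent_space_def plus_fun_def times_fun_def)

lemma tangent_zero: "v \<in> tangent_space M p \<Longrightarrow> v (\<lambda>_. 0) = 0"
  using tangent_cmult[of v M p "\<lambda>_. 0" 0] by (simp add: C_inf_const)

lemma tangent_diff:
  assumes "v \<in> tangent_space M p" "f \<in> C_inf M" "g \<in> C_inf M"
  shows "v (\<lambda>x. f x - g x) = v f - v g"
  using tangent_add[OF assms(1), of "\<lambda>x. f x - g x" g] assms by (simp add: C_inf_diff)

lemma tangent_sum:
  assumes "v \<in> tangent_space M p" "\<And>i. i \<in> I \<Longrightarrow> f i \<in> C_inf M"
  shows "v (\<lambda>x. \<Sum>i\<in>I. f i x) = (\<Sum>i\<in>I. v (f i))"
  using assms(2)
  by (induction I rule: infinite_finite_induct)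
    (simp_all add: tangent_zero[OF assms(1)] tangent_add[OF assms(1)] C_inf_sum)

lemma chart_facts:
  assumes "smooth_manifold M" "(U, \<phi>) \<in> atlas M"
  shows "open U" "openin (top_of_set (model M)) (\<phi> ` U)" "homeomorphism U (\<phi> ` U) \<phi> (inv_into U \<phi>)"
    "subspace (model M)" "\<And>q. q \<in> U \<Longrightarrow> inv_into U \<phi> (\<phi> q) = q"
  using assms unfolding smooth_manifold_def homeomorphism_def by fast+

lemma chart_transition:
  assumes "smooth_manifold M" "(U, \<phi>) \<in> atlas M" "(W, \<psi>) \<in> atlas M"
  shows "smooth_on (model M) (\<phi> ` (U \<inter> W)) (\<lambda>x. \<psi> (inv_into U \<phi> x))"
  using assms unfolding smooth_manifold_def comp_def by fast

lemma openin_chart_image: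
  assumes "smooth_manifold M" "(U, \<phi>) \<in> atlas M" "open S"
  shows "openin (top_of_set (model M)) (\<phi> ` (U \<inter> S))"
  using homeomorphism_imp_open_map[OF chart_facts(3)[OF assms(1,2)] openin_open_Int[OF assms(3)]]
    chart_facts(2)[OF assms(1,2)] openin_trans by blast

lemma open_chart_preimage:
  assumes M: "smooth_manifold M" "(U, \<phi>) \<in> atlas M"
    and S: "openin (top_of_set (model M)) S" "S \<subseteq> \<phi> ` U"
  shows "open (inv_into U \<phi> ` S)"
proof -
  have "openin (top_of_set (\<phi> ` U)) S"
    using S openin_subset_trans chart_facts(2)[OF M] openin_imp_subset by metis
  then have "openin (top_of_set U) (inv_into U \<phi> ` S)"
    using homeomorphism_imp_open_map homeomorphism_sym chart_facts(3)[OF M] by blast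
  then show ?thesis using chart_facts(1)[OF M] openin_open_trans by blast
qed

definition extend_by_zero :: "'m set \<Rightarrow> ('m \<Rightarrow> 'e) \<Rightarrow> 'e set \<Rightarrow> ('e \<Rightarrow> real) \<Rightarrow> 'm \<Rightarrow> real" where
  "extend_by_zero U \<phi> S F q = (if q \<in> U \<and> \<phi> q \<in> S then F (\<phi> q) else 0)"

text \<open>
  In another chart, the extension is a composition with a smooth coordinate change on the image of
  \<^term>\<open>S\<close> and vanishes on the complement of the image of \<^term>\<open>K\<close>. The latter is open, since a
  compact set is closed in a Hausdorff space.
\<close>

lemma extend_by_zero_smooth:
  assumes M: "smooth_manifold M" and U: "(U, \<phi>) \<in> atlas M"
    and S: "openin (top_of_set (model M)) S" "S \<subseteq> \<phi> ` U"
    and K: "compact K" "K \<subseteq> S" and F: "smooth_on (model M) S F" and F0: "\<And>x. x \<in> S - K \<Longrightarrow> F x = 0"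
  shows "extend_by_zero U \<phi> S F \<in> C_inf M"
proof -
  have "smooth_on (model M) (\<psi> ` W) (extend_by_zero U \<phi> S F \<circ> inv_into W \<psi>)"
    if W: "(W, \<psi>) \<in> atlas M" for W \<psi>
  proof -
    let ?f = "extend_by_zero U \<phi> S F \<circ> inv_into W \<psi>"
    define A where "A = inv_into U \<phi> ` S"
    define C where "C = inv_into U \<phi> ` K"
    note cU = chart_facts[OF M U] and cW = chart_facts[OF M W]
    have A: "q \<in> U" "\<phi> q \<in> S" if "q \<in> A" for q
      using that S(2) cU(5) by (auto simp: A_def)
    have "continuous_on K (inv_into U \<phi>)"
      using cU(3) K(2) S(2) by (meson continuous_on_subset homeomorphism_def order_trans)
    then have "closed C" unfolding C_def by (intro compact_imp_closed compact_continuous_image K)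
    have "smooth_on (model M) (\<psi> ` (W \<inter> A) \<union> \<psi> ` (W \<inter> - C)) ?f"
    proof (rule smooth_on_Un)
      show "openin (top_of_set (model M)) (\<psi> ` (W \<inter> A))"
        using openin_chart_image[OF M W] open_chart_preimage[OF M U S] A_def by blast
      show "openin (top_of_set (model M)) (\<psi> ` (W \<inter> - C))"
        using openin_chart_image[OF M W] \<open>closed C\<close> by blast
      show "smooth_on (model M) (\<psi> ` (W \<inter> A)) ?f"
      proof (rule smooth_on_cong)
        show "smooth_on (model M) (\<psi> ` (W \<inter> A)) (\<lambda>x. F (\<phi> (inv_into W \<psi> x)))"
        proof (rule smooth_on_compose[OF cU(4) _ F])
          show "S \<subseteq> model M" using S(1) openin_imp_subset by blast
          show "smooth_on (model M) (\<psi> ` (W \<inter> A)) (\<lambda>x. \<phi> (inv_into W \<psi> x))"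
            by (rule smooth_on_subset[OF chart_transition[OF M W U]]) (use A in auto)
          show "(\<lambda>x. \<phi> (inv_into W \<psi> x)) ` \<psi> ` (W \<inter> A) \<subseteq> S" using A cW(5) by auto
        qed
      qed (use A cW(5) in \<open>auto simp: extend_by_zero_def\<close>)
      show "smooth_on (model M) (\<psi> ` (W \<inter> - C)) ?f"
      proof (rule smooth_on_cong[OF smooth_on_const[of _ _ 0]])
        fix x assume "x \<in> \<psi> ` (W \<inter> - C)"
        then obtain q where q: "x = \<psi> q" "q \<in> W" "q \<notin> C" by blast
        then have "\<phi> q \<notin> K" if "q \<in> U" using cU(5)[OF that] unfolding C_def by (metis imageI)
        then show "?f x = 0" using q cW(5) F0 by (auto simp: extend_by_zero_def)
      qed
    qed (rule cU(4))
    moreover have "\<psi> ` W = \<psi> ` (W \<inter> A) \<union> \<psi> ` (W \<inter> - C)"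
      using image_mono[OF K(2), of "inv_into U \<phi>"] unfolding A_def C_def by blast
    ultimately show ?thesis by simp
  qed
  then show ?thesis by (auto simp: C_inf_def)
qed

text \<open>
  The neighbourhood \<^term>\<open>S\<close> is a ball in the model space, hence convex, as Hadamard's lemma
  requires. Since the bump has the value 1 at the centre, multiplying by it a function that vanishes
  there does not change the value of a derivation on that function.
\<close>

lemma bump_in_chart:
  fixes \<phi> :: "'m::{t2_space, second_countable_topology} \<Rightarrow> 'e::euclidean_space"
  assumes M: "smooth_manifold M" and U: "(U, \<phi>) \<in> atlas M" and p: "p \<in> U"
  obtains S K and \<rho> :: "'e \<Rightarrow> real" where "openin (top_of_set (model M)) S" "convex S" "S \<subseteq> \<phi> ` U" "\<phi> p \<in> S"
    "compact K" "K \<subseteq> S" "smooth_on (model M) S \<rho>" "\<rho> (\<phi> p) = 1" "\<forall>x\<in>S - K. \<rho> x = 0"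
proof -
  let ?V = "model M" and ?a = "\<phi> p"
  note c = chart_facts[OF M U]
  have a: "?a \<in> ?V" using p c(2) openin_imp_subset by blast
  obtain r where r: "r > 0" "cball ?a r \<inter> ?V \<subseteq> \<phi> ` U"
    using c(2) p unfolding openin_contains_cball by blast
  \<comment> \<open>The bump has to vanish outside a compact subset of the open ball of radius r.\<close>
  define s where "s = r / 2"
  have s: "0 < s" "s < r" using r(1) by (auto simp: s_def)
  let ?\<rho> = "\<lambda>x. flat 1 (s\<^sup>2 - (norm (x - ?a))\<^sup>2) * inverse (flat 1 (s\<^sup>2))"
  show thesis
  proof (rule that[of "?V \<inter> ball ?a r" "?V \<inter> cball ?a s" ?\<rho>])
    show "openin (top_of_set ?V) (?V \<inter> ball ?a r)" by (simp add: openin_open_Int)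
    show "convex (?V \<inter> ball ?a r)" by (simp add: convex_Int subspace_imp_convex c(4))
    show "compact (?V \<inter> cball ?a s)"
      by (simp add: closed_Int_compact closed_subspace c(4))
    show "smooth_on ?V (?V \<inter> ball ?a r) ?\<rho>"
      by (intro smooth_on_mult smooth_on_bump smooth_on_const)
    show "?\<rho> ?a = 1" using s by (simp add: flat_def)
    show "\<forall>x\<in>(?V \<inter> ball ?a r) - (?V \<inter> cball ?a s). ?\<rho> x = 0"
    proof
      fix x assume "x \<in> (?V \<inter> ball ?a r) - (?V \<inter> cball ?a s)"
      then have "s < norm (x - ?a)" by (auto simp: dist_norm norm_minus_commute)
      then have "s\<^sup>2 < (norm (x - ?a))\<^sup>2" using s by (intro power_strict_mono) auto
      then show "?\<rho> x = 0" by (simp add: flat_def)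
    qed
  qed (use r s a in auto)
qed

section \<open>Extending tangent vectors to vector fields\<close>

lemma dir_deriv_add:
  assumes "subspace V" "openin (top_of_set V) U" "smooth_on V U f" "smooth_on V U g" "x \<in> U" "v \<in> V"
  shows "dir_deriv (\<lambda>x. f x + g x) v x = dir_deriv f v x + dir_deriv g v x"
proof -
  obtain D where D: "(f has_derivative D) (at x within U)" "\<And>v. v \<in> V \<Longrightarrow> D v = dir_deriv f v x"
    using smooth_on_has_derivative_dir_deriv assms by metis
  obtain E where E: "(g has_derivative E) (at x within U)" "\<And>v. v \<in> V \<Longrightarrow> E v = dir_deriv g v x"
    using smooth_on_has_derivative_dir_deriv assms by metis
  show ?thesis
    using has_derivative_imp_dir_deriv[OF assms(1,2,5,6) has_derivative_add[OF D(1) E(1)]] D E assms(6) by simp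
qed

lemma dir_deriv_mult:
  fixes f g :: "'a::euclidean_space \<Rightarrow> real"
  assumes "subspace V" "openin (top_of_set V) U" "smooth_on V U f" "smooth_on V U g" "x \<in> U" "v \<in> V"
  shows "dir_deriv (\<lambda>x. f x * g x) v x = f x * dir_deriv g v x + dir_deriv f v x * g x"
proof -
  obtain D where D: "(f has_derivative D) (at x within U)" "\<And>v. v \<in> V \<Longrightarrow> D v = dir_deriv f v x"
    using smooth_on_has_derivative_dir_deriv assms by metis
  obtain E where E: "(g has_derivative E) (at x within U)" "\<And>v. v \<in> V \<Longrightarrow> E v = dir_deriv g v x"
    using smooth_on_has_derivative_dir_deriv assms by metis
  show ?thesis
    using has_derivative_imp_dir_deriv[OF assms(1,2,5,6) has_derivative_mult[OF D(1) E(1)]] D E assms(6) by simp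
qed

lemma dir_deriv_const [simp]: "dir_deriv (\<lambda>_. c) v x = 0"
  by (simp add: dir_deriv_def)

text \<open>
  A constant coordinate field $\partial_w$, cut off by a bump function, is a global vector field.
\<close>

lemma coordinate_vector_field:
  assumes M: "smooth_manifold M" and U: "(U, \<phi>) \<in> atlas M"
    and S: "openin (top_of_set (model M)) S" "S \<subseteq> \<phi> ` U"
    and K: "compact K" "K \<subseteq> S" and \<rho>: "smooth_on (model M) S \<rho>" "\<And>x. x \<in> S - K \<Longrightarrow> \<rho> x = 0"
    and w: "w \<in> model M"
  shows "(\<lambda>q f. if f \<in> C_inf M
      then extend_by_zero U \<phi> S (\<lambda>x. \<rho> x * dir_deriv (f \<circ> inv_into U \<phi>) w x) q else 0) \<in> vector_fields M"
    (is "?Y \<in> _")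
proof -
  let ?V = "model M" and ?\<iota> = "inv_into U \<phi>"
  note c = chart_facts[OF M U]
  have sm: "smooth_on ?V (\<phi> ` U) (\<lambda>x. f (?\<iota> x))" if "f \<in> C_inf M" for f
    using that U by (auto simp: C_inf_def comp_def)
  have "?Y q \<in> tangent_space M q" for q
  proof -
    have 1: "?Y q (\<lambda>x. f x + g x) = ?Y q f + ?Y q g" if "f \<in> C_inf M" "g \<in> C_inf M" for f g
      using that dir_deriv_add[OF c(4,2) sm[OF that(1)] sm[OF that(2)] _ w]
      by (auto simp: extend_by_zero_def C_inf_add comp_def algebra_simps)
    have 2: "?Y q (\<lambda>x. f x * g x) = f q * ?Y q g + g q * ?Y q f" if "f \<in> C_inf M" "g \<in> C_inf M" for f g
      using that dir_deriv_mult[OF c(4,2) sm[OF that(1)] sm[OF that(2)] _ w] c(5)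
      by (auto simp: extend_by_zero_def C_inf_mult comp_def algebra_simps)
    have 3: "?Y q (\<lambda>x. k * f x) = k * ?Y q f" if "f \<in> C_inf M" for f k
      using 2[OF C_inf_const[of k] that] by (simp add: extend_by_zero_def comp_def C_inf_const)
    show ?thesis
      using 1 2 3 by (simp add: tangent_space_def plus_fun_def times_fun_def)
  qed
  moreover have "(\<lambda>q. ?Y q f) \<in> C_inf M" if "f \<in> C_inf M" for f
  proof -
    have "smooth_on ?V S (\<lambda>x. \<rho> x * dir_deriv (f \<circ> ?\<iota>) w x)"
      using smooth_on_subset[OF smooth_on_dir_deriv[OF c(4,2) sm[OF that] w] S(2)] \<rho>(1)
      by (auto intro: smooth_on_mult simp: comp_def)
    then show ?thesis
      using extend_by_zero_smooth[OF M U S K] \<rho>(2) that by simp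
  qed
  ultimately show ?thesis by (simp add: vector_fields_def)
qed

text \<open>
  A derivation at a point is a directional derivative in a chart. By Hadamard's lemma,
  $f = f(p) + \sum_b (x - a)_b\, g_b$ near $p$, and the product rule leaves only
  $v(f) = \sum_b g_b(a)\, v((x-a)_b) = \partial_w f(a)$, where $w$ collects the values of $v$ on the
  coordinates. Both the coordinates and the $g_b$ exist only locally, so each factor is first
  multiplied by the bump function $\rho$, which turns the expansion into one of $\rho^2 f$.
\<close>

lemma vector_field_extension_exists:
  fixes M :: "('a::{t2_space, second_countable_topology}, 'b::euclidean_space) manifold"
  assumes M: "smooth_manifold M" and v: "v \<in> tangent_space M p"
  shows "\<exists>Y\<in>vector_fields M. Y p = v"
proof -
  let ?V = "model M"
  obtain U \<phi> where U: "(U, \<phi>) \<in> atlas M" and p: "p \<in> U"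
    using M unfolding smooth_manifold_def by fast
  let ?\<iota> = "inv_into U \<phi>" and ?a = "\<phi> p"
  note c = chart_facts[OF M U]
  obtain S K and \<rho> :: "'b \<Rightarrow> real" where S: "openin (top_of_set ?V) S" and conv: "convex S"
    and SU: "S \<subseteq> \<phi> ` U" and a: "?a \<in> S" and K: "compact K" "K \<subseteq> S"
    and \<rho>: "smooth_on ?V S \<rho>" and \<rho>1: "\<rho> ?a = 1" and \<rho>0': "\<forall>x\<in>S - K. \<rho> x = 0"
    by (rule bump_in_chart[OF M U p])
  have \<rho>0: "\<And>x. x \<in> S - K \<Longrightarrow> \<rho> x = 0" using \<rho>0' by blast
  obtain P where P: "bounded_linear P" "\<And>x. P x \<in> ?V" "\<And>x. x \<in> ?V \<Longrightarrow> P x = x"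
    using subspace_projection[OF c(4)] by metis
  let ?ext = "\<lambda>F. extend_by_zero U \<phi> S (\<lambda>x. \<rho> x * F x)"
  have ext: "?ext F \<in> C_inf M" if "smooth_on ?V S F" for F
    by (rule extend_by_zero_smooth[OF M U S SU K smooth_on_mult[OF \<rho> that]]) (simp add: \<rho>0)
  let ?X = "\<lambda>b. ?ext (\<lambda>x. (x - ?a) \<bullet> b)"
  have X: "?X b \<in> C_inf M" for b
    by (intro ext smooth_on_linear_image[OF bounded_linear_inner_left] smooth_on_diff smooth_on_const
        smooth_on_bounded_linear bounded_linear_ident)
  \<comment> \<open>The coordinate functions of the ambient space restrict to the model space, so the basis vectors
    that they belong to are projected there.\<close>
  define w where "w = (\<Sum>b\<in>Basis. v (?X b) *\<^sub>R P b)"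
  have w: "w \<in> ?V" unfolding w_def by (intro subspace_sum subspace_scale c(4) P(2))
  let ?Y = "\<lambda>q f. if f \<in> C_inf M then ?ext (dir_deriv (f \<circ> ?\<iota>) w) q else 0"
  have "v f = dir_deriv (f \<circ> ?\<iota>) w ?a" if f: "f \<in> C_inf M" for f
  proof -
    have "smooth_on ?V (\<phi> ` U) (f \<circ> ?\<iota>)" using f U by (auto simp: C_inf_def)
    then have sm: "smooth_on ?V S (f \<circ> ?\<iota>)" using SU by (rule smooth_on_subset)
    obtain g where g: "\<And>b. smooth_on ?V S (g b)" "\<And>b. g b ?a = dir_deriv (f \<circ> ?\<iota>) (P b) ?a"
      "\<And>x. x \<in> S \<Longrightarrow> (f \<circ> ?\<iota>) x = (f \<circ> ?\<iota>) ?a + (\<Sum>b\<in>Basis. ((x - ?a) \<bullet> b) * g b x)"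
      using hadamard[OF c(4) S conv a sm P] by blast
    let ?R = "?ext (\<lambda>_. 1)" and ?G = "\<lambda>b. ?ext (g b)"
    have R: "?R \<in> C_inf M" by (intro ext smooth_on_const)
    have G: "?G b \<in> C_inf M" for b by (intro ext g)
    let ?R2 = "\<lambda>q. ?R q * ?R q"
    have R2: "?R2 \<in> C_inf M" by (intro C_inf_mult R)
    have "?R2 q * f q = f p * ?R2 q + (\<Sum>b\<in>Basis. ?X b q * ?G b q)" for q
    proof (cases "q \<in> U \<and> \<phi> q \<in> S")
      case True
      then have "f q = f p + (\<Sum>b\<in>Basis. ((\<phi> q - ?a) \<bullet> b) * g b (\<phi> q))"
        using g(3)[of "\<phi> q"] c(5) p by simp
      then show ?thesis
        using True by (simp add: extend_by_zero_def sum_distrib_left algebra_simps)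
    qed (auto simp: extend_by_zero_def)
    then have "v (\<lambda>q. ?R2 q * f q) = v (\<lambda>q. f p * ?R2 q + (\<Sum>b\<in>Basis. ?X b q * ?G b q))" by simp
    also have "\<dots> = f p * v ?R2 + (\<Sum>b\<in>Basis. v (\<lambda>q. ?X b q * ?G b q))"
      using R2 X G by (simp add: tangent_add[OF v] tangent_cmult[OF v] tangent_sum[OF v] C_inf_mult C_inf_const C_inf_sum)
    \<comment> \<open>The cut-off coordinates vanish at p, so each product contributes a single term.\<close>
    also have "\<dots> = f p * v ?R2 + (\<Sum>b\<in>Basis. g b ?a * v (?X b))"
      using p a \<rho>1 by (simp add: tangent_mult[OF v X G]) (simp add: extend_by_zero_def)
    finally have "v (\<lambda>q. ?R2 q * f q) = f p * v ?R2 + (\<Sum>b\<in>Basis. g b ?a * v (?X b))" .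
    moreover have "v (\<lambda>q. ?R2 q * f q) = ?R2 p * v f + f p * v ?R2"
      by (rule tangent_mult[OF v R2 f])
    moreover have "?R p = 1" using p a \<rho>1 by (simp add: extend_by_zero_def)
    ultimately have "v f = (\<Sum>b\<in>Basis. g b ?a * v (?X b))" by simp
    also have "\<dots> = dir_deriv (f \<circ> ?\<iota>) w ?a"
    proof -
      obtain D where D: "((f \<circ> ?\<iota>) has_derivative D) (at ?a within S)"
        "\<And>v. v \<in> ?V \<Longrightarrow> D v = dir_deriv (f \<circ> ?\<iota>) v ?a"
        using smooth_on_has_derivative_dir_deriv[OF c(4) S sm a] by blast
      have lin: "linear D" using has_derivative_linear[OF D(1)] .
      have "dir_deriv (f \<circ> ?\<iota>) w ?a = D w" using D(2)[OF w] by simp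
      also have "\<dots> = (\<Sum>b\<in>Basis. v (?X b) * D (P b))"
        by (simp add: w_def linear_sum[OF lin] linear_cmul[OF lin])
      finally show ?thesis by (simp add: D(2)[OF P(2)] g(2) mult.commute)
    qed
    finally show ?thesis .
  qed
  then have "\<forall>f. ?Y p f = v f"
    using p a \<rho>1 tangent_not_smooth[OF v] by (simp add: extend_by_zero_def)
  then have "?Y p = v" unfolding fun_eq_iff .
  moreover have "?Y \<in> vector_fields M" by (rule coordinate_vector_field[OF M U S SU K \<rho> \<rho>0 w])
  ultimately show ?thesis by (rule rev_bexI[rotated])
qed

section \<open>Cartan calculus for one-forms\<close>

lemma tangent_space_add:
  "v \<in> tangent_space M p \<Longrightarrow> w \<in> tangent_space M p \<Longrightarrow> v + w \<in> tangent_space M p"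
  and tangent_space_scale: "v \<in> tangent_space M p \<Longrightarrow> (\<lambda>f. c * v f) \<in> tangent_space M p"
  by (auto simp: tangent_space_def algebra_simps)

lemma cotangent_add:
  "a \<in> cotangent_space M p \<Longrightarrow> v \<in> tangent_space M p \<Longrightarrow> w \<in> tangent_space M p \<Longrightarrow> a (v + w) = a v + a w"
  and cotangent_scale:
  "a \<in> cotangent_space M p \<Longrightarrow> v \<in> tangent_space M p \<Longrightarrow> a (\<lambda>f. c * v f) = c * a v"
  by (auto simp: cotangent_space_def)

lemma one_forms_cotangent: "\<alpha> \<in> one_forms M \<Longrightarrow> \<alpha> p \<in> cotangent_space M p"
  and one_forms_smooth: "\<alpha> \<in> one_forms M \<Longrightarrow> X \<in> vector_fields M \<Longrightarrow> pairing \<alpha> X \<in> C_inf M"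
  by (auto simp: one_forms_def pairing_def[abs_def])

lemma vector_fields_tangent: "X \<in> vector_fields M \<Longrightarrow> X p \<in> tangent_space M p"
  and vector_fields_smooth: "X \<in> vector_fields M \<Longrightarrow> f \<in> C_inf M \<Longrightarrow> (\<lambda>p. X p f) \<in> C_inf M"
  by (auto simp: vector_fields_def)

definition scale_field :: "('m \<Rightarrow> real) \<Rightarrow> 'm vfield \<Rightarrow> 'm vfield" where
  "scale_field h X = (\<lambda>p f. h p * X p f)"

lemma zero_vector_field: "0 \<in> vector_fields M"
  by (auto simp: vector_fields_def tangent_space_def C_inf_const)

lemma add_vector_field: "X \<in> vector_fields M \<Longrightarrow> Y \<in> vector_fields M \<Longrightarrow> X + Y \<in> vector_fields M"
  by (auto simp: vector_fields_def tangent_space_add tangent_space_scale C_inf_add)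

lemma scale_vector_field: "h \<in> C_inf M \<Longrightarrow> X \<in> vector_fields M \<Longrightarrow> scale_field h X \<in> vector_fields M"
  by (auto simp: vector_fields_def scale_field_def tangent_space_add tangent_space_scale C_inf_mult)

text \<open>
  In the product rule the mixed terms $X(f)\,Y(g) + Y(f)\,X(g)$ are symmetric in $X$ and $Y$ and cancel.
\<close>

lemma lie_bracket_vector_field:
  assumes X: "X \<in> vector_fields M" and Y: "Y \<in> vector_fields M"
  shows "lie_bracket X Y \<in> vector_fields M"
proof -
  note t = vector_fields_tangent[OF X] vector_fields_tangent[OF Y]
  note s = vector_fields_smooth[OF X] vector_fields_smooth[OF Y]
  have "lie_bracket X Y p \<in> tangent_space M p" for p
  proof -
    have "lie_bracket X Y p (\<lambda>x. f x + g x) = lie_bracket X Y p f + lie_bracket X Y p g"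
      if "f \<in> C_inf M" "g \<in> C_inf M" for f g
      using that by (simp add: lie_bracket_def t[THEN tangent_add] s)
    moreover have "lie_bracket X Y p (\<lambda>x. c * f x) = c * lie_bracket X Y p f"
      if "f \<in> C_inf M" for f c
      using that by (simp add: lie_bracket_def t[THEN tangent_cmult] s algebra_simps)
    moreover have "lie_bracket X Y p (\<lambda>x. f x * g x) = f p * lie_bracket X Y p g + g p * lie_bracket X Y p f"
      if "f \<in> C_inf M" "g \<in> C_inf M" for f g
      using that
      by (simp add: lie_bracket_def t[THEN tangent_mult] t[THEN tangent_add] s C_inf_mult algebra_simps)
    moreover have "lie_bracket X Y p f = 0" if "f \<notin> C_inf M" for f
      using that by (simp add: lie_bracket_def t[THEN tangent_not_smooth] t[THEN tangent_zero])
    ultimately show ?thesis by (simp add: tangent_space_def plus_fun_def times_fun_def)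
  qed
  moreover have "(\<lambda>p. lie_bracket X Y p f) \<in> C_inf M" if "f \<in> C_inf M" for f
    unfolding lie_bracket_def using that by (intro C_inf_diff s)
  ultimately show ?thesis by (simp add: vector_fields_def)
qed

text \<open>
  At a given tangent vector, all Lie derivatives are computed with the same extending field, which
  makes their dependence on \<^term>\<open>X\<close> explicit.
\<close>

lemma lie_form_eq:
  assumes M: "smooth_manifold M" and v: "v \<in> tangent_space M p"
  obtains Y where "Y \<in> vector_fields M" "Y p = v"
    "\<forall>X \<alpha>. lie_form M X \<alpha> p v = X p (pairing \<alpha> Y) - \<alpha> p (lie_bracket X Y p)"
proof -
  have "\<exists>Y. Y \<in> vector_fields M \<and> Y p = v" using vector_field_extension_exists[OF M v] by blast
  then have "extension M p v \<in> vector_fields M \<and> extension M p v p = v"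
    unfolding extension_def by (rule someI_ex)
  then show thesis
    using v by (intro that[of "extension M p v"]) (auto simp: lie_form_def Let_def lie_fun_def pairing_def)
qed

lemma lie_form_add:
  assumes M: "smooth_manifold M" and X: "X \<in> vector_fields M" "X' \<in> vector_fields M" and \<alpha>: "\<alpha> \<in> one_forms M"
  shows "lie_form M (X + X') \<alpha> = lie_form M X \<alpha> + lie_form M X' \<alpha>"
proof (intro ext)
  fix p v
  show "lie_form M (X + X') \<alpha> p v = (lie_form M X \<alpha> + lie_form M X' \<alpha>) p v"
  proof (cases "v \<in> tangent_space M p")
    case True
    obtain Y where Y: "Y \<in> vector_fields M" "Y p = v"
      "\<forall>X \<alpha>. lie_form M X \<alpha> p v = X p (pairing \<alpha> Y) - \<alpha> p (lie_bracket X Y p)"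
      by (rule lie_form_eq[OF M True])
    note t = vector_fields_tangent and b = lie_bracket_vector_field[OF _ Y(1)]
    have "lie_bracket (X + X') Y p f = (lie_bracket X Y p + lie_bracket X' Y p) f" for f
    proof (cases "f \<in> C_inf M")
      case True
      then show ?thesis
        using X by (simp add: lie_bracket_def tangent_add[OF t[OF Y(1)]] vector_fields_smooth)
    next
      case False
      then show ?thesis
        using tangent_not_smooth[OF t[OF b[OF add_vector_field[OF X]]] False]
        by (simp add: tangent_not_smooth[OF t[OF b[OF X(1)]]] tangent_not_smooth[OF t[OF b[OF X(2)]]])
    qed
    then have "lie_bracket (X + X') Y p = lie_bracket X Y p + lie_bracket X' Y p" by (intro ext)
    then show ?thesis
      using cotangent_add[OF one_forms_cotangent[OF \<alpha>] t t, OF b b, OF X] by (simp add: Y(3))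
  qed (simp add: lie_form_def)
qed

text \<open>
  From $[hX, Y] = h[X,Y] - Y(h) X$ the second term contributes $Y(h)\,\alpha(X)$, which at the given
  point is $dh(v)\,\alpha(X)$ because $Y$ extends $v$.
\<close>

lemma lie_form_scale:
  assumes M: "smooth_manifold M" and h: "h \<in> C_inf M" and X: "X \<in> vector_fields M" and \<alpha>: "\<alpha> \<in> one_forms M"
  shows "lie_form M (scale_field h X) \<alpha> = h \<cdot>\<^sub>f lie_form M X \<alpha> + pairing \<alpha> X \<cdot>\<^sub>f differential M h"
proof (intro ext)
  fix p v
  show "lie_form M (scale_field h X) \<alpha> p v = (h \<cdot>\<^sub>f lie_form M X \<alpha> + pairing \<alpha> X \<cdot>\<^sub>f differential M h) p v"
  proof (cases "v \<in> tangent_space M p")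
    case v: True
    obtain Y where Y: "Y \<in> vector_fields M" "Y p = v"
      "\<forall>X \<alpha>. lie_form M X \<alpha> p v = X p (pairing \<alpha> Y) - \<alpha> p (lie_bracket X Y p)"
      by (rule lie_form_eq[OF M v])
    note t = vector_fields_tangent and b = lie_bracket_vector_field[OF _ Y(1)]
    have "lie_bracket (scale_field h X) Y p f = (\<lambda>f. h p * lie_bracket X Y p f) f + (\<lambda>f. - v h * X p f) f" for f
    proof (cases "f \<in> C_inf M")
      case True
      then show ?thesis
        using X by (simp add: lie_bracket_def scale_field_def tangent_mult[OF v h] Y(2)
            vector_fields_smooth algebra_simps)
    next
      case False
      then show ?thesis
        using tangent_not_smooth[OF t[OF b[OF scale_vector_field[OF h X]]]]
        by (simp add: tangent_not_smooth[OF t[OF b[OF X]]] tangent_not_smooth[OF t[OF X]])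
    qed
    then have "lie_bracket (scale_field h X) Y p = (\<lambda>f. h p * lie_bracket X Y p f) + (\<lambda>f. - v h * X p f)"
      by (simp add: plus_fun_def fun_eq_iff)
    moreover have "\<alpha> p ((\<lambda>f. h p * lie_bracket X Y p f) + (\<lambda>f. - v h * X p f))
        = \<alpha> p (\<lambda>f. h p * lie_bracket X Y p f) + \<alpha> p (\<lambda>f. - v h * X p f)"
      by (intro cotangent_add[OF one_forms_cotangent[OF \<alpha>]] tangent_space_scale t X b)
    ultimately have "\<alpha> p (lie_bracket (scale_field h X) Y p) = h p * \<alpha> p (lie_bracket X Y p) - v h * \<alpha> p (X p)"
      by (simp only: cotangent_scale[OF one_forms_cotangent[OF \<alpha>] t[OF X]]
          cotangent_scale[OF one_forms_cotangent[OF \<alpha>] t[OF b[OF X]]])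
    then show ?thesis
      using v by (simp add: Y(3) scale_form_def differential_def pairing_def scale_field_def algebra_simps)
  qed (simp add: lie_form_def scale_form_def differential_def)
qed

lemma lie_form_zero:
  assumes M: "smooth_manifold M" and \<alpha>: "\<alpha> \<in> one_forms M"
  shows "lie_form M 0 \<alpha> = 0"
  using lie_form_add[OF M zero_vector_field zero_vector_field \<alpha>] by simp

lemma sum_vector_field:
  "(\<And>i. i \<in> I \<Longrightarrow> X i \<in> vector_fields M) \<Longrightarrow> (\<Sum>i\<in>I. X i) \<in> vector_fields M"
  by (induction I rule: infinite_finite_induct) (simp_all add: zero_vector_field add_vector_field)

lemma lie_form_sum:
  assumes "smooth_manifold M" "\<And>i. i \<in> I \<Longrightarrow> X i \<in> vector_fields M" "\<alpha> \<in> one_forms M"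
  shows "lie_form M (\<Sum>i\<in>I. X i) \<alpha> = (\<Sum>i\<in>I. lie_form M (X i) \<alpha>)"
  using assms(2)
  by (induction I rule: infinite_finite_induct)
    (simp_all add: lie_form_zero assms lie_form_add sum_vector_field)

lemma sum_fun_apply: "(\<Sum>i\<in>I. F i) x = (\<Sum>i\<in>I. F i x)"
  by (induction I rule: infinite_finite_induct) auto

lemma pairing_add:
  assumes "\<beta> \<in> one_forms M" "X \<in> vector_fields M" "Y \<in> vector_fields M"
  shows "pairing \<beta> (X + Y) = pairing \<beta> X + pairing \<beta> Y"
  using cotangent_add[OF assms(1)[THEN one_forms_cotangent] assms(2,3)[THEN vector_fields_tangent]]
  by (simp add: pairing_def fun_eq_iff)

lemma pairing_zero: "\<beta> \<in> one_forms M \<Longrightarrow> pairing \<beta> 0 = 0"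
  using pairing_add[OF _ zero_vector_field zero_vector_field] by fastforce

lemma pairing_scale:
  assumes "\<beta> \<in> one_forms M" "X \<in> vector_fields M"
  shows "pairing \<beta> (scale_field h X) = h * pairing \<beta> X"
  using cotangent_scale[OF assms(1)[THEN one_forms_cotangent] assms(2)[THEN vector_fields_tangent]]
  by (simp add: pairing_def fun_eq_iff scale_field_def)

lemma pairing_sum:
  assumes "\<beta> \<in> one_forms M" "\<And>i. i \<in> I \<Longrightarrow> X i \<in> vector_fields M"
  shows "pairing \<beta> (\<Sum>i\<in>I. X i) = (\<Sum>i\<in>I. pairing \<beta> (X i))"
  using assms(2)
  by (induction I rule: infinite_finite_induct)
    (simp_all add: pairing_zero[OF assms(1)] pairing_add[OF assms(1)] sum_vector_field)

lemma differential_one_form: "f \<in> C_inf M \<Longrightarrow> differential M f \<in> one_forms M"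
  by (auto simp: one_forms_def cotangent_space_def differential_def tangent_space_add tangent_space_scale
      vector_fields_smooth vector_fields_tangent)

text \<open>
  Differentials of smooth functions are one-forms, and pairing with them recovers the derivation.
\<close>

lemma vector_field_eqI:
  assumes X: "X \<in> vector_fields M" and Y: "Y \<in> vector_fields M"
    and eq: "\<And>\<beta>. \<beta> \<in> one_forms M \<Longrightarrow> pairing \<beta> X = pairing \<beta> Y"
  shows "X = Y"
proof (intro ext)
  fix p f
  note t = vector_fields_tangent[OF X, of p] vector_fields_tangent[OF Y, of p]
  show "X p f = Y p f"
  proof (cases "f \<in> C_inf M")
    case True
    then show ?thesis
      using fun_cong[OF eq[OF differential_one_form[OF True]], of p] t by (simp add: pairing_def differential_def)
  qed (simp add: t[THEN tangent_not_smooth])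
qed

lemma sharp_eqI:
  assumes "X \<in> vector_fields M" "\<And>\<beta>. \<beta> \<in> one_forms M \<Longrightarrow> pairing \<beta> X = bivector_eval \<Lambda> \<alpha> \<beta>"
  shows "sharp M \<Lambda> \<alpha> = X"
  unfolding sharp_def using assms by (intro the_equality) (auto intro!: vector_field_eqI)

lemma wedge_pair_eval:
  assumes "\<alpha> \<in> one_forms M" "\<beta> \<in> one_forms M"
  shows "bivector_eval (wedge M [X, Y]) \<alpha> \<beta> = pairing \<alpha> X * pairing \<beta> Y - pairing \<beta> X * pairing \<alpha> Y"
  using assms[THEN one_forms_cotangent]
  by (auto simp: bivector_eval_def vec_wedge_def remove_nth_def pairing_def fun_eq_iff lessThan_Suc numeral_2_eq_2)

lemma C_inf_uminus: "f \<in> C_inf M \<Longrightarrow> - f \<in> C_inf M"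
  using C_inf_diff[OF C_inf_const[of 0]] by (simp add: fun_Compl_def)

lemma differential_mult:
  assumes "f \<in> C_inf M" "g \<in> C_inf M"
  shows "differential M (\<lambda>x. f x * g x) p v = f p * differential M g p v + g p * differential M f p v"
  using assms by (simp add: differential_def tangent_mult)

lemma differential_diff:
  assumes "f \<in> C_inf M" "g \<in> C_inf M"
  shows "differential M (\<lambda>x. f x - g x) p v = differential M f p v - differential M g p v"
  using assms by (simp add: differential_def tangent_diff)

lemma differential_uminus: "f \<in> C_inf M \<Longrightarrow> differential M (- f) p v = - differential M f p v"
  using tangent_cmult[of v M p f "- 1"] by (simp add: differential_def fun_Compl_def)

lemma differential_sum:
  assumes "\<And>i. i \<in> I \<Longrightarrow> f i \<in> C_inf M"
  shows "differential M (\<lambda>x. \<Sum>i\<in>I. f i x) p v = (\<Sum>i\<in>I. differential M (f i) p v)"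
  using tangent_sum[of v M p I f] assms by (auto simp: differential_def)

section \<open>The musical map of a decomposed bivector field\<close>

locale decomposed_bivector =
  fixes M :: "('m::{t2_space, second_countable_topology}, 'e::euclidean_space) manifold"
    and \<Lambda> :: "'m mvfield" and m :: nat and L U :: "nat \<Rightarrow> 'm vfield"
  assumes M: "smooth_manifold M"
    and L: "\<And>\<kappa>. \<kappa> \<in> {1..m} \<Longrightarrow> L \<kappa> \<in> vector_fields M"
    and U: "\<And>\<kappa>. \<kappa> \<in> {1..m} \<Longrightarrow> U \<kappa> \<in> vector_fields M"
    and \<Lambda>: "\<Lambda> = (\<Sum>\<kappa>=1..m. wedge M [L \<kappa>, U \<kappa>])"
begin

lemma decomposed_bivector_eval:
  assumes "\<alpha> \<in> one_forms M" "\<beta> \<in> one_forms M"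
  shows "bivector_eval \<Lambda> \<alpha> \<beta> =
    (\<lambda>p. \<Sum>\<kappa>=1..m. pairing \<alpha> (L \<kappa>) p * pairing \<beta> (U \<kappa>) p - pairing \<beta> (L \<kappa>) p * pairing \<alpha> (U \<kappa>) p)"
proof
  fix p
  have "bivector_eval \<Lambda> \<alpha> \<beta> p = (\<Sum>\<kappa>=1..m. bivector_eval (wedge M [L \<kappa>, U \<kappa>]) \<alpha> \<beta> p)"
    by (simp only: bivector_eval_def \<Lambda> sum_fun_apply)
  then show "bivector_eval \<Lambda> \<alpha> \<beta> p = (\<Sum>\<kappa>=1..m. pairing \<alpha> (L \<kappa>) p * pairing \<beta> (U \<kappa>) p - pairing \<beta> (L \<kappa>) p * pairing \<alpha> (U \<kappa>) p)"
    by (simp only: wedge_pair_eval[OF assms]) simp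
qed

abbreviation contracted_field :: "'m form1 \<Rightarrow> 'm vfield" where
  "contracted_field \<alpha> \<equiv>
    (\<Sum>\<kappa>=1..m. scale_field (pairing \<alpha> (L \<kappa>)) (U \<kappa>) + scale_field (- pairing \<alpha> (U \<kappa>)) (L \<kappa>))"

lemma scaled_vector_fields:
  assumes \<alpha>: "\<alpha> \<in> one_forms M" and "\<kappa> \<in> {1..m}"
  shows "scale_field (pairing \<alpha> (L \<kappa>)) (U \<kappa>) \<in> vector_fields M"
    "scale_field (- pairing \<alpha> (U \<kappa>)) (L \<kappa>) \<in> vector_fields M"
  using assms(2) by (auto intro!: scale_vector_field C_inf_uminus one_forms_smooth[OF \<alpha>] L U)

lemma pairing_contracted_field:
  assumes \<alpha>: "\<alpha> \<in> one_forms M" and \<beta>: "\<beta> \<in> one_forms M"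
  shows "pairing \<beta> (contracted_field \<alpha>) = bivector_eval \<Lambda> \<alpha> \<beta>"
proof -
  have "pairing \<beta> (contracted_field \<alpha>)
    = (\<Sum>\<kappa>=1..m. pairing \<alpha> (L \<kappa>) * pairing \<beta> (U \<kappa>) + (- pairing \<alpha> (U \<kappa>)) * pairing \<beta> (L \<kappa>))"
    by (subst pairing_sum[OF \<beta>])
      (auto simp only: pairing_add[OF \<beta>] pairing_scale[OF \<beta>] L U scaled_vector_fields[OF \<alpha>]
        intro!: add_vector_field sum.cong)
  then show ?thesis
    by (simp add: decomposed_bivector_eval[OF \<alpha> \<beta>] fun_eq_iff sum_fun_apply mult.commute)
qed

lemma decomposed_sharp:
  assumes \<alpha>: "\<alpha> \<in> one_forms M"
  shows "sharp M \<Lambda> \<alpha> = contracted_field \<alpha>"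
  by (rule sharp_eqI) (intro sum_vector_field add_vector_field scaled_vector_fields[OF \<alpha>] pairing_contracted_field[OF \<alpha>]; assumption)+

lemma pairing_decomposed_sharp:
  assumes "\<alpha> \<in> one_forms M" "\<beta> \<in> one_forms M"
  shows "pairing \<beta> (sharp M \<Lambda> \<alpha>) = bivector_eval \<Lambda> \<alpha> \<beta>"
  using assms by (simp only: decomposed_sharp pairing_contracted_field)

text \<open>
  The first sum is the one in the definition of \<^const>\<open>nabla\<close>; the second, the error, collects the
  terms $\beta(X)\,dh$ by which the Lie derivative fails to be function-linear in its field.
\<close>

lemma lie_form_decomposed_sharp:
  assumes \<alpha>: "\<alpha> \<in> one_forms M" and \<beta>: "\<beta> \<in> one_forms M"
  shows "lie_form M (sharp M \<Lambda> \<alpha>) \<beta> p v =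
    (\<Sum>\<kappa>=1..m. pairing \<alpha> (L \<kappa>) p * lie_form M (U \<kappa>) \<beta> p v - pairing \<alpha> (U \<kappa>) p * lie_form M (L \<kappa>) \<beta> p v)
    + (\<Sum>\<kappa>=1..m. pairing \<beta> (U \<kappa>) p * differential M (pairing \<alpha> (L \<kappa>)) p v
                - pairing \<beta> (L \<kappa>) p * differential M (pairing \<alpha> (U \<kappa>)) p v)"
proof -
  have h: "pairing \<alpha> (L \<kappa>) \<in> C_inf M" "pairing \<alpha> (U \<kappa>) \<in> C_inf M" "- pairing \<alpha> (U \<kappa>) \<in> C_inf M"
    if "\<kappa> \<in> {1..m}" for \<kappa>
    using that by (auto intro!: C_inf_uminus one_forms_smooth[OF \<alpha>] L U)
  have "lie_form M (sharp M \<Lambda> \<alpha>) \<beta> =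
      (\<Sum>\<kappa>=1..m. lie_form M (scale_field (pairing \<alpha> (L \<kappa>)) (U \<kappa>)) \<beta>
        + lie_form M (scale_field (- pairing \<alpha> (U \<kappa>)) (L \<kappa>)) \<beta>)"
    unfolding decomposed_sharp[OF \<alpha>]
    by (subst lie_form_sum[OF M _ \<beta>])
      (auto intro!: sum.cong lie_form_add[OF M _ _ \<beta>] add_vector_field scale_vector_field h L U)
  also have "\<dots> = (\<Sum>\<kappa>=1..m. (pairing \<alpha> (L \<kappa>) \<cdot>\<^sub>f lie_form M (U \<kappa>) \<beta> + pairing \<beta> (U \<kappa>) \<cdot>\<^sub>f differential M (pairing \<alpha> (L \<kappa>)))
      + (- pairing \<alpha> (U \<kappa>) \<cdot>\<^sub>f lie_form M (L \<kappa>) \<beta> + pairing \<beta> (L \<kappa>) \<cdot>\<^sub>f differential M (- pairing \<alpha> (U \<kappa>))))"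
    by (intro sum.cong refl) (simp only: lie_form_scale[OF M _ _ \<beta>] h L U)
  finally show ?thesis
    by (simp add: sum_fun_apply scale_form_def differential_uminus h sum.distrib[symmetric] algebra_simps del: One_nat_def)
qed

text \<open>
  The product rule splits $d(\Lambda(\alpha,\beta))$ into two sums: the error sum of the preceding lemma
  for $(\alpha, \beta)$, minus the one for $(\beta, \alpha)$.
\<close>

lemma differential_decomposed_bivector_eval:
  assumes \<alpha>: "\<alpha> \<in> one_forms M" and \<beta>: "\<beta> \<in> one_forms M"
  shows "differential M (bivector_eval \<Lambda> \<alpha> \<beta>) p v =
    (\<Sum>\<kappa>=1..m. pairing \<beta> (U \<kappa>) p * differential M (pairing \<alpha> (L \<kappa>)) p v
              - pairing \<beta> (L \<kappa>) p * differential M (pairing \<alpha> (U \<kappa>)) p v)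
  - (\<Sum>\<kappa>=1..m. pairing \<alpha> (U \<kappa>) p * differential M (pairing \<beta> (L \<kappa>)) p v
              - pairing \<alpha> (L \<kappa>) p * differential M (pairing \<beta> (U \<kappa>)) p v)"
proof -
  let ?a = "\<lambda>X \<kappa>. pairing \<alpha> (X \<kappa>)" and ?b = "\<lambda>X \<kappa>. pairing \<beta> (X \<kappa>)"
  have sm: "?a L \<kappa> \<in> C_inf M" "?a U \<kappa> \<in> C_inf M" "?b L \<kappa> \<in> C_inf M" "?b U \<kappa> \<in> C_inf M"
    if "\<kappa> \<in> {1..m}" for \<kappa>
    using one_forms_smooth[OF \<alpha>] one_forms_smooth[OF \<beta>] L[OF that] U[OF that] by blast+
  have "differential M (bivector_eval \<Lambda> \<alpha> \<beta>) p v
    = (\<Sum>\<kappa>=1..m. differential M (\<lambda>p. ?a L \<kappa> p * ?b U \<kappa> p - ?b L \<kappa> p * ?a U \<kappa> p) p v)"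
    unfolding decomposed_bivector_eval[OF \<alpha> \<beta>]
    by (intro differential_sum C_inf_diff C_inf_mult sm)
  also have "\<dots> = (\<Sum>\<kappa>=1..m. (?a L \<kappa> p * differential M (?b U \<kappa>) p v + ?b U \<kappa> p * differential M (?a L \<kappa>) p v)
      - (?b L \<kappa> p * differential M (?a U \<kappa>) p v + ?a U \<kappa> p * differential M (?b L \<kappa>) p v))"
    by (intro sum.cong refl) (simp only: differential_diff differential_mult C_inf_mult sm)
  finally show ?thesis
    by (simp add: sum_subtractf[symmetric] algebra_simps del: One_nat_def)
qed

end

section \<open>The bracket as an antisymmetrised connection\<close>

theorem proposition3p1:
  fixes M :: "('m::{t2_space, second_countable_topology}, 'e::euclidean_space) manifold"
    and \<Lambda> :: "'m mvfield" and \<epsilon> :: "'m vfield"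
    and m :: nat and L U :: "nat \<Rightarrow> 'm vfield"
    and \<alpha> \<beta> :: "'m form1" and f g :: "'m \<Rightarrow> real"
  assumes "jacobi_manifold M \<Lambda> \<epsilon>"
    and "\<And>\<kappa>. \<kappa> \<in> {1..m} \<Longrightarrow> L \<kappa> \<in> vector_fields M"
    and "\<And>\<kappa>. \<kappa> \<in> {1..m} \<Longrightarrow> U \<kappa> \<in> vector_fields M"
    and "\<Lambda> = (\<Sum>\<kappa>=1..m. wedge M [L \<kappa>, U \<kappa>])"
    and "\<alpha> \<in> one_forms M" and "\<beta> \<in> one_forms M"
    and "f \<in> C_inf M" and "g \<in> C_inf M"
  shows "jacobi_bracket M \<Lambda> \<epsilon> (\<alpha>, f) (\<beta>, g)
       = nabla M \<epsilon> m L U (\<alpha>, f) (\<beta>, g) - nabla M \<epsilon> m L U (\<beta>, g) (\<alpha>, f)"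
proof -
  have M: "smooth_manifold M" using assms(1) by (simp add: jacobi_manifold_def)
  interpret decomposed_bivector M \<Lambda> m L U
    by unfold_locales (use M assms(2-4) in auto)
  note \<alpha> = assms(5) and \<beta> = assms(6)
  note df = differential_decomposed_bivector_eval[OF \<alpha> \<beta>] and lf = lie_form_decomposed_sharp
  have "fst (jacobi_bracket M \<Lambda> \<epsilon> (\<alpha>, f) (\<beta>, g)) p v
      = fst (nabla M \<epsilon> m L U (\<alpha>, f) (\<beta>, g) - nabla M \<epsilon> m L U (\<beta>, g) (\<alpha>, f)) p v" for p v
    by (simp add: jacobi_bracket_def nabla_def lf \<alpha> \<beta> df sum_fun_apply scale_form_def contract2_def
        form_wedge_def pairing_def[of _ \<epsilon>] algebra_simps del: One_nat_def)
  moreover have "snd (jacobi_bracket M \<Lambda> \<epsilon> (\<alpha>, f) (\<beta>, g)) p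
      = snd (nabla M \<epsilon> m L U (\<alpha>, f) (\<beta>, g) - nabla M \<epsilon> m L U (\<beta>, g) (\<alpha>, f)) p" for p
  proof -
    have lie: "lie_fun (sharp M \<Lambda> \<gamma>) h p =
        (\<Sum>\<kappa>=1..m. pairing \<gamma> (L \<kappa>) p * lie_fun (U \<kappa>) h p - pairing \<gamma> (U \<kappa>) p * lie_fun (L \<kappa>) h p)"
      if "\<gamma> \<in> one_forms M" for \<gamma> h
      by (simp add: decomposed_sharp that lie_fun_def sum_fun_apply scale_field_def)
    \<comment> \<open>Antisymmetry of the pairing turns the difference of two halves into the whole term.\<close>
    have pair: "pairing \<alpha> (sharp M \<Lambda> \<beta>) = bivector_eval \<Lambda> \<beta> \<alpha>"
      by (rule pairing_decomposed_sharp[OF \<beta> \<alpha>])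
    show ?thesis
      by (simp add: jacobi_bracket_def nabla_def lie \<alpha> \<beta> pair sum_fun_apply
          decomposed_bivector_eval[OF \<beta> \<alpha>] sum_subtractf algebra_simps)
  qed
  ultimately show ?thesis by (simp add: prod_eq_iff fun_eq_iff)
qed

end
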